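(* There exist absolute constants $C>0$ and $T_0\in\mathbb{Z}_{>0}$ such that for any $b,h\in[0,1]$, $K\ge 0$, $L\in\mathbb{Z}_{\ge 0}$, $U>0$, $T\in\mathbb{Z}_{\ge T_0}$, any probability distribution $\mathcal{D}$ on $[0,U]^{T+L}$, and any $N\in\mathbb{Z}_{>0}$, taking $\Pi_{(s,S)}=\{(s,S):\underline{H}\le s\le S\le H,\ S\ge 0\}$ with $H=(L+1)U/h$ and $\underline{H}=(L+1)U(1-1/b)$, $$\mathbb{E}_{\mathbf{d}_1,\dots,\mathbf{d}_N\sim\mathcal{D}}\big[\mathrm{EE}(\mathcal{L}(\Pi_{(s,S)}))\big]\le \mathbb{E}_{\mathbf{d}_1,\dots,\mathbf{d}_N\sim\mathcal{D}}\big[\mathrm{GE}(\mathcal{L}(\Pi_{(s,S)}))\big]\le C\,\big((L+1)U+K\big)\sqrt{\frac{\log T}{N}}.$$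
   Context: Inventory model (backlogged demand, lead time $L$). There are $T+L$ periods; a demand sequence is $\mathbf{d}=(d^1,\dots,d^{T+L})\in[0,U]^{T+L}$. Let $x^t$ be the inventory level at the beginning of period $t$ and $q^t\ge 0$ the quantity ordered in period $t$ (arriving in period $t+L$), with $q^t=0$ for $t\le 0$. The inventory position before ordering is $I^t=x^t+\sum_{t'=t-L}^{t-1}q^{t'}$. After replenishment the inventory level is $y^t=x^t+q^{t-L}$, and $x^{t+1}=y^t-d^t$. Let $c(x)=h\max\{x,0\}+b\max\{-x,0\}$. The loss in period $t$ of a policy $\pi$ is $\ell^t(\pi,\mathbf{d})=c(y^t-d^t)+K\cdot\mathbb{I}\{q^{t-L}>0\}$, and the loss is $\ell(\pi,\mathbf{d})=\frac1T\sum_{t=L+1}^{T+L}\ell^t(\pi,\mathbf{d})$. $(s,S)$ policies: the policy $(s,S)$ (with $s,S$ real) orders $q^t=(S-I^t)\cdot\mathbb{I}\{I^t\le s\}$ in every period $t\ge 1$. The initial level $x^1$ is a fixed non-positive constant with $x^1\le\underline{H}$, so that replenishment up to $S$ always occurs in period 1. Conventions for degenerate parameters: if $h=0$ then $H=+\infty$; if $b=0$ then $\underline{H}=-\infty$, $x^1$ is any fixed non-positive constant, and every policy is taken to order $q^1=S-x^1$ in period 1. Errors: $\mathbf{d}_1,\dots,\mathbf{d}_N$ are i.i.d. from $\mathcal{D}$; $\mathcal{L}(\Pi)=\{\ell(\pi,\cdot):\pi\in\Pi\}$; $R(\pi)=\mathbb{E}_{\mathbf{d}\sim\mathcal{D}}[\ell(\pi,\mathbf{d})]$;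 $\hat R(\pi)=\frac1N\sum_{i=1}^N\ell(\pi,\mathbf{d}_i)$. The generalization error is $\mathrm{GE}(\mathcal{L}(\Pi))=\sup_{\pi\in\Pi}\{R(\pi)-\hat R(\pi)\}$. The estimation error is $\mathrm{EE}(\mathcal{L}(\Pi))=R(\hat\pi)-R(\pi^* )$, where $\hat\pi\in\arg\inf_{\pi\in\Pi}\hat R(\pi)$ and $\pi^*\in\arg\inf_{\pi\in\Pi}R(\pi)$ (minimizers presumed to exist). *)

theory Defs
  imports "HOL-Probability.Probability"
begin

text \<open>A replenishment policy maps the period and the inventory position before ordering
  to the order quantity.\<close>

type_synonym policy = "nat \<Rightarrow> real \<Rightarrow> real"

text \<open>Periods are numbered from 1. No order is placed in a period at or before 0; as the order
  in period 0 is 0, truncated subtraction of the lead time yields exactly this. The inventory level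
  in the fictitious period 0 is never used.\<close>

fun inv_level :: "nat \<Rightarrow> real \<Rightarrow> policy \<Rightarrow> (nat \<Rightarrow> real) \<Rightarrow> nat \<Rightarrow> real"
  and order_qty :: "nat \<Rightarrow> real \<Rightarrow> policy \<Rightarrow> (nat \<Rightarrow> real) \<Rightarrow> nat \<Rightarrow> real"
where
  "inv_level L x1 \<pi> d 0 = x1"
| "inv_level L x1 \<pi> d (Suc t) =
     (if t = 0 then x1 else inv_level L x1 \<pi> d t + order_qty L x1 \<pi> d (t - L) - d t)"
| "order_qty L x1 \<pi> d t =
     (if t = 0 then 0
      else \<pi> t (inv_level L x1 \<pi> d t + (\<Sum>t'\<in>{t - L..<t}. order_qty L x1 \<pi> d t')))"

declare inv_level.simps [simp del] order_qty.simps [simp del]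

definition level_after_replenishment ::
  "nat \<Rightarrow> real \<Rightarrow> policy \<Rightarrow> (nat \<Rightarrow> real) \<Rightarrow> nat \<Rightarrow> real" where
  "level_after_replenishment L x1 \<pi> d t = inv_level L x1 \<pi> d t + order_qty L x1 \<pi> d (t - L)"

definition holding_backlog_cost :: "real \<Rightarrow> real \<Rightarrow> real \<Rightarrow> real" where
  "holding_backlog_cost h b x = h * max x 0 + b * max (- x) 0"

definition period_loss ::
  "real \<Rightarrow> real \<Rightarrow> real \<Rightarrow> nat \<Rightarrow> real \<Rightarrow> policy \<Rightarrow> (nat \<Rightarrow> real) \<Rightarrow> nat \<Rightarrow> real" where
  "period_loss h b K L x1 \<pi> d t =
     holding_backlog_cost h b (level_after_replenishment L x1 \<pi> d t - d t)
     + K * of_bool (order_qty L x1 \<pi> d (t - L) > 0)"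

definition policy_loss ::
  "real \<Rightarrow> real \<Rightarrow> real \<Rightarrow> nat \<Rightarrow> nat \<Rightarrow> real \<Rightarrow> policy \<Rightarrow> (nat \<Rightarrow> real) \<Rightarrow> real" where
  "policy_loss h b K L T x1 \<pi> d = (1 / real T) * (\<Sum>t = L + 1..T + L. period_loss h b K L x1 \<pi> d t)"

text \<open>For positive backlogging cost the initial level is assumed low enough to trigger an
  order in period 1. For \<open>b = 0\<close> the reorder point is unbounded below, and the order in
  period 1 is placed by convention.\<close>

definition sS_policy :: "real \<Rightarrow> real \<times> real \<Rightarrow> policy" where
  "sS_policy b = (\<lambda>(s, S) t I. (S - I) * of_bool (I \<le> s \<or> (b = 0 \<and> t = 1)))"

definition sS_loss ::
  "real \<Rightarrow> real \<Rightarrow> real \<Rightarrow> nat \<Rightarrow> nat \<Rightarrow> real \<Rightarrow> real \<times> real \<Rightarrow> (nat \<Rightarrow> real) \<Rightarrow> real" where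
  "sS_loss h b K L T x1 p = policy_loss h b K L T x1 (sS_policy b p)"

definition H_upper :: "real \<Rightarrow> nat \<Rightarrow> real \<Rightarrow> ereal" where
  "H_upper h L U = (if h = 0 then \<infinity> else ereal ((real L + 1) * U / h))"

definition H_lower :: "real \<Rightarrow> nat \<Rightarrow> real \<Rightarrow> ereal" where
  "H_lower b L U = (if b = 0 then - \<infinity> else ereal ((real L + 1) * U * (1 - 1 / b)))"

definition sS_class :: "real \<Rightarrow> real \<Rightarrow> nat \<Rightarrow> real \<Rightarrow> (real \<times> real) set" where
  "sS_class h b L U =
     {(s, S). H_lower b L U \<le> ereal s \<and> s \<le> S \<and> ereal S \<le> H_upper h L U \<and> 0 \<le> S}"

text \<open>The Borel space \<open>[0, U]\<^sup>n\<close>, with coordinates indexed by \<open>1, \<dots>, n\<close>.\<close>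

definition demand_space :: "nat \<Rightarrow> real \<Rightarrow> (nat \<Rightarrow> real) measure" where
  "demand_space n U = Pi\<^sub>M {1..n} (\<lambda>_. restrict_space borel {0..U})"

definition iid_sample :: "nat \<Rightarrow> 'd measure \<Rightarrow> (nat \<Rightarrow> 'd) measure" where
  "iid_sample N D = Pi\<^sub>M {1..N} (\<lambda>_. D)"

definition risk :: "'d measure \<Rightarrow> ('p \<Rightarrow> 'd \<Rightarrow> real) \<Rightarrow> 'p \<Rightarrow> real" where
  "risk D loss p = (\<integral>d. loss p d \<partial>D)"

definition empirical_risk :: "nat \<Rightarrow> (nat \<Rightarrow> 'd) \<Rightarrow> ('p \<Rightarrow> 'd \<Rightarrow> real) \<Rightarrow> 'p \<Rightarrow> real" where
  "empirical_risk N ds loss p = (1 / real N) * (\<Sum>i = 1..N. loss p (ds i))"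

definition generalization_error ::
  "'d measure \<Rightarrow> nat \<Rightarrow> ('p \<Rightarrow> 'd \<Rightarrow> real) \<Rightarrow> 'p set \<Rightarrow> (nat \<Rightarrow> 'd) \<Rightarrow> real" where
  "generalization_error D N loss A ds = (SUP p\<in>A. risk D loss p - empirical_risk N ds loss p)"

text \<open>The error is determined by a choice of an empirical minimizer and of a true minimizer,
  neither of which need be unique.\<close>

definition estimation_error ::
  "'d measure \<Rightarrow> ('p \<Rightarrow> 'd \<Rightarrow> real) \<Rightarrow> 'p \<Rightarrow> 'p \<Rightarrow> real" where
  "estimation_error D loss p_hat p_star = risk D loss p_hat - risk D loss p_star"

end

theory Submission imports Defs begin

text \<open>After the first order, the shortfall of the inventory position below \<open>S\<close> depends on the policy
  only through \<open>\<delta> = S - s\<close>, and \<open>\<delta>\<close> enters only through comparisons with the at most $T^2$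
  demands accumulated over intervals of periods. Hence the losses form a curve in \<open>\<delta>\<close> with at most
  $T^2$ jumps, and, for fixed \<open>\<delta>\<close>, a curve in \<open>S\<close> of bounded variation. Cutting the range of the
  mean number of interval demands below \<open>\<delta>\<close>, and of the mean of a monotone majorant of the
  variation in \<open>S\<close>, into pieces of length $2^{-k}$ gives $O(T^2 4^k)$ brackets of $L^1$ width
  $O(2^{-k})$. Chaining over these brackets costs $\sqrt{\log T / N}$.\<close>

section \<open>Exponential moments of empirical averages\<close>

text \<open>A tiny change of \<delta> across an accumulated demand can alter all later orders, so
  closeness of parameters gives no uniform closeness of losses; closeness is measured in L^1 under
  \<open>D\<close> instead. The link is that the interval count is integer valued: where it is
  unchanged all order decisions agree, and where it changes its increment is at least 1, which
  dominates any difference of losses rescaled to [0, 1]. The range of S is cut through a mean cost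
  and not through S itself, because S is unbounded for h = 0 and s for b = 0, whereas the costs per
  period stay within (L + 1) U. For functions with values in [-1, 1] the L^1 norm bounds the second
  moment, which is what the exponential moments use at each level. Brackets are built for finite
  sets of parameters, with a bound that does not depend on the set; left continuity extends it
  through rational parameters to the whole class. The constant 148 is 2 * (44 + 15 * 2): the number
  of brackets at level k is at most exp (4 ln T (k + 1)), whence the factor 2 = sqrt 4, and their
  L^1 width is at most 2 / 2^k.\<close>

lemma exp_le_quadratic:
  fixes y :: real
  assumes "\<bar>y\<bar> \<le> 1"
  shows "exp y \<le> 1 + y + y\<^sup>2"
proof (cases "y \<ge> 0")
  case True
  then show ?thesis using assms exp_bound[of y] by simp
next
  case False
  define z where "z = - y"
  have z: "0 \<le> z" using False z_def by simp
  have p: "0 < 1 + z + z\<^sup>2 / 2" using z by (simp add: add_pos_nonneg)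
  \<comment> \<open>For a negative argument, exp (- z) is bounded by the reciprocal of the quadratic
    Taylor minorant of exp z. Multiplying that minorant by 1 - z + z^2 cancels the linear term and
    leaves only nonnegative coefficients.\<close>
  have "1 \<le> 1 + z\<^sup>2 / 2 + z ^ 3 / 2 + z ^ 4 / 2" using z by simp
  also have "\<dots> = (1 - z + z\<^sup>2) * (1 + z + z\<^sup>2 / 2)"
    by (simp add: power2_eq_square power3_eq_cube power4_eq_xxxx field_simps)
  finally have "1 / (1 + z + z\<^sup>2 / 2) \<le> 1 - z + z\<^sup>2"
    using p by (simp add: divide_le_eq)
  moreover have "1 / exp z \<le> 1 / (1 + z + z\<^sup>2 / 2)"
    using exp_lower_Taylor_quadratic[OF z] p by (intro divide_left_mono) auto
  ultimately show ?thesis by (simp add: z_def exp_minus field_simps)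
qed

text \<open>Signed as in the generalization error, but attached to a function and not to a
  parameter, so that it also applies to increments and envelopes, which are losses of no
  policy.\<close>

definition emp_gap :: "'d measure \<Rightarrow> nat \<Rightarrow> ('d \<Rightarrow> real) \<Rightarrow> (nat \<Rightarrow> 'd) \<Rightarrow> real" where
  "emp_gap D N \<phi> ds = (\<integral>x. \<phi> x \<partial>D) - (\<Sum>i = 1..N. \<phi> (ds i)) / real N"

lemma risk_minus_empirical_risk:
  "risk D loss p - empirical_risk N ds loss p = emp_gap D N (loss p) ds"
  by (simp add: risk_def empirical_risk_def emp_gap_def)

context prob_space
begin

lemma integrable_bounded:
  fixes f :: "'a \<Rightarrow> real"
  assumes "f \<in> borel_measurable M" and "\<And>x. x \<in> space M \<Longrightarrow> \<bar>f x\<bar> \<le> B"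
  shows "integrable M f"
  by (rule integrable_const_bound[where B = B]) (use assms in auto)

lemma iid_sample_prob_space: "prob_space (iid_sample N M)"
proof -
  interpret product_prob_space "\<lambda>_::nat. M" "{1..N}" by unfold_locales
  show ?thesis unfolding iid_sample_def by (rule P.prob_space_axioms)
qed

lemma iid_sample_component:
  assumes "ds \<in> space (iid_sample N M)" "i \<in> {1..N}"
  shows "ds i \<in> space M"
  using assms by (auto simp: iid_sample_def space_PiM)

lemma iid_sample_measurable [measurable]:
  assumes "i \<in> {1..N}"
  shows "(\<lambda>ds. ds i) \<in> measurable (iid_sample N M) M"
  unfolding iid_sample_def using assms by measurable

lemma emp_gap_measurable [measurable]:
  assumes [measurable]: "\<phi> \<in> borel_measurable M"
  shows "emp_gap M N \<phi> \<in> borel_measurable (iid_sample N M)"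
  unfolding emp_gap_def by measurable

lemma abs_emp_gap_le:
  assumes m: "\<phi> \<in> borel_measurable M" and b: "\<And>x. x \<in> space M \<Longrightarrow> \<phi> x \<in> {0..B}"
    and ds: "ds \<in> space (iid_sample N M)" and "N > 0"
  shows "\<bar>emp_gap M N \<phi> ds\<bar> \<le> B"
proof -
  have i: "integrable M \<phi>"
    by (rule integrable_bounded[OF m, of B]) (use b in fastforce)
  have "0 \<le> (\<integral>x. \<phi> x \<partial>M)"
    by (rule integral_nonneg_AE) (use b in auto)
  moreover have "(\<integral>x. \<phi> x \<partial>M) \<le> B"
    by (rule integral_le_const[OF i]) (use b in auto)
  moreover have c: "\<phi> (ds i) \<in> {0..B}" if "i \<in> {1..N}" for i
    using b iid_sample_component[OF ds that] by blast
  then have "0 \<le> (\<Sum>i = 1..N. \<phi> (ds i)) / real N"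
    by (intro divide_nonneg_nonneg sum_nonneg) auto
  moreover have "(\<Sum>i = 1..N. \<phi> (ds i)) \<le> (\<Sum>i = 1..N. B)"
    by (rule sum_mono) (use c in auto)
  then have "(\<Sum>i = 1..N. \<phi> (ds i)) / real N \<le> B"
    using \<open>N > 0\<close> by (simp add: divide_le_eq mult.commute)
  ultimately show ?thesis unfolding emp_gap_def by linarith
qed

lemma integral_iid_sample_prod:
  fixes f :: "'a \<Rightarrow> real"
  assumes "integrable M f"
  shows "integrable (iid_sample N M) (\<lambda>ds. \<Prod>i = 1..N. f (ds i))"
    and "(\<integral>ds. (\<Prod>i = 1..N. f (ds i)) \<partial>iid_sample N M) = (\<integral>x. f x \<partial>M) ^ N"
proof -
  interpret product_prob_space "\<lambda>_::nat. M" "{1..N}" by unfold_locales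
  show "integrable (iid_sample N M) (\<lambda>ds. \<Prod>i = 1..N. f (ds i))"
    unfolding iid_sample_def using assms by (intro product_integrable_prod) auto
  show "(\<integral>ds. (\<Prod>i = 1..N. f (ds i)) \<partial>iid_sample N M) = (\<integral>x. f x \<partial>M) ^ N"
    unfolding iid_sample_def using assms by (subst product_integral_prod) auto
qed

lemma distr_iid_sample_component:
  assumes "i \<in> {1..N}"
  shows "distr (iid_sample N M) M (\<lambda>ds. ds i) = M"
proof -
  interpret product_prob_space "\<lambda>_::nat. M" "{1..N}" by unfold_locales
  show ?thesis unfolding iid_sample_def by (rule PiM_component[OF assms])
qed

lemma integrable_iid_sample_component:
  fixes f :: "'a \<Rightarrow> real"
  assumes "integrable M f" "i \<in> {1..N}"
  shows "integrable (iid_sample N M) (\<lambda>ds. f (ds i))"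
  by (rule integrable_distr[where M' = M])
    (use assms in \<open>simp_all add: distr_iid_sample_component iid_sample_measurable\<close>)

lemma integral_iid_sample_component:
  fixes f :: "'a \<Rightarrow> real"
  assumes "f \<in> borel_measurable M" "i \<in> {1..N}"
  shows "(\<integral>ds. f (ds i) \<partial>iid_sample N M) = (\<integral>x. f x \<partial>M)"
  using integral_distr[OF iid_sample_measurable[OF assms(2)] assms(1)]
  by (simp add: distr_iid_sample_component[OF assms(2)])

text \<open>Both \<phi> and its mean lie in [-1, 1], so t \<le> 1/2 keeps the exponent in [-1, 1],
  where exp y \<le> 1 + y + y^2. The linear term integrates to zero and the quadratic one to t^2
  times the variance. Keeping v, and not just the range, lets finer levels profit from smaller
  increments.\<close>

lemma integral_exp_centered_le:
  fixes \<phi> :: "'a \<Rightarrow> real"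
  assumes m [measurable]: "\<phi> \<in> borel_measurable M" and b: "\<And>x. x \<in> space M \<Longrightarrow> \<bar>\<phi> x\<bar> \<le> 1"
    and v: "(\<integral>x. (\<phi> x)\<^sup>2 \<partial>M) \<le> v" and t: "0 \<le> t" "2 * t \<le> 1"
  defines "\<mu> \<equiv> \<integral>x. \<phi> x \<partial>M"
  shows "integrable M (\<lambda>x. exp (t * (\<mu> - \<phi> x)))"
    and "(\<integral>x. exp (t * (\<mu> - \<phi> x)) \<partial>M) \<le> exp (t\<^sup>2 * v)"
proof -
  have i [simp]: "integrable M \<phi>"
    by (rule integrable_bounded[OF m b])
  have i2 [simp]: "integrable M (\<lambda>x. (\<phi> x)\<^sup>2)"
    by (rule integrable_bounded[where B = 1]) (use b in \<open>auto simp: abs_square_le_1\<close>)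
  have "\<mu> \<le> 1" unfolding \<mu>_def
    by (rule integral_le_const[OF i]) (use b in fastforce)
  moreover have "-1 \<le> \<mu>" unfolding \<mu>_def
    by (rule integral_ge_const[OF i]) (use b in fastforce)
  ultimately have "\<bar>\<mu>\<bar> \<le> 1" by simp
  have y: "\<bar>t * (\<mu> - \<phi> x)\<bar> \<le> 1" if "x \<in> space M" for x
  proof -
    have "\<bar>\<mu> - \<phi> x\<bar> \<le> 2" using b[OF that] \<open>\<bar>\<mu>\<bar> \<le> 1\<close> by linarith
    then have "t * \<bar>\<mu> - \<phi> x\<bar> \<le> t * 2" using t by (intro mult_left_mono) auto
    then show ?thesis using t by (simp add: abs_mult)
  qed
  show ie: "integrable M (\<lambda>x. exp (t * (\<mu> - \<phi> x)))"
    by (rule integrable_bounded[where B = "exp 1"]) (use y in \<open>auto intro: order_trans[OF abs_ge_self]\<close>)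
  have exp2: "1 + t * (\<mu> - \<phi> x) + (t * (\<mu> - \<phi> x))\<^sup>2 =
      (1 + t * \<mu> + t\<^sup>2 * \<mu>\<^sup>2) - (t + 2 * t\<^sup>2 * \<mu>) * \<phi> x + t\<^sup>2 * (\<phi> x)\<^sup>2" for x
    by (simp add: power2_eq_square algebra_simps)
  have "(\<integral>x. exp (t * (\<mu> - \<phi> x)) \<partial>M) \<le> (\<integral>x. 1 + t * (\<mu> - \<phi> x) + (t * (\<mu> - \<phi> x))\<^sup>2 \<partial>M)"
    using ie exp_le_quadratic[OF y] by (intro integral_mono) (auto simp: exp2)
  also have "\<dots> = 1 + t\<^sup>2 * ((\<integral>x. (\<phi> x)\<^sup>2 \<partial>M) - \<mu>\<^sup>2)"
    unfolding exp2 by (simp add: prob_space flip: \<mu>_def) (simp add: power2_eq_square algebra_simps)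
  also have "\<dots> \<le> 1 + t\<^sup>2 * v"
    using v by (simp add: mult_left_mono) (smt (verit) mult_left_mono zero_le_power2)
  also have "\<dots> \<le> exp (t\<^sup>2 * v)" by (rule exp_ge_add_one_self)
  finally show "(\<integral>x. exp (t * (\<mu> - \<phi> x)) \<partial>M) \<le> exp (t\<^sup>2 * v)" .
qed

lemma integral_exp_emp_gap_le:
  assumes m: "\<phi> \<in> borel_measurable M" and b: "\<And>x. x \<in> space M \<Longrightarrow> \<bar>\<phi> x\<bar> \<le> 1"
    and v: "(\<integral>x. (\<phi> x)\<^sup>2 \<partial>M) \<le> v" and l: "0 \<le> l" "2 * l \<le> real N" and "N > 0"
  shows "integrable (iid_sample N M) (\<lambda>ds. exp (l * emp_gap M N \<phi> ds))"
    and "(\<integral>ds. exp (l * emp_gap M N \<phi> ds) \<partial>iid_sample N M) \<le> exp (l\<^sup>2 * v / real N)"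
proof -
  define \<mu> where "\<mu> = (\<integral>x. \<phi> x \<partial>M)"
  define F where "F = (\<lambda>x. exp (l / real N * (\<mu> - \<phi> x)))"
  have t: "0 \<le> l / real N" "2 * (l / real N) \<le> 1" using l \<open>N > 0\<close> by (auto simp: field_simps)
  have i: "integrable M F" and le: "(\<integral>x. F x \<partial>M) \<le> exp ((l / real N)\<^sup>2 * v)"
    unfolding F_def \<mu>_def using integral_exp_centered_le[OF m b v t] by auto
  have eq: "exp (l * emp_gap M N \<phi> ds) = (\<Prod>i = 1..N. F (ds i))" for ds
  proof -
    have "(\<Sum>i = 1..N. l / real N * (\<mu> - \<phi> (ds i))) = l * emp_gap M N \<phi> ds"
      using \<open>N > 0\<close> unfolding sum_distrib_left [symmetric] sum_subtractf
      by (simp add: emp_gap_def \<mu>_def field_simps)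
    then show ?thesis by (simp add: F_def exp_sum [symmetric])
  qed
  show "integrable (iid_sample N M) (\<lambda>ds. exp (l * emp_gap M N \<phi> ds))"
    unfolding eq by (rule integral_iid_sample_prod[OF i])
  have "(\<integral>ds. exp (l * emp_gap M N \<phi> ds) \<partial>iid_sample N M) = (\<integral>x. F x \<partial>M) ^ N"
    unfolding eq by (rule integral_iid_sample_prod[OF i])
  also have "\<dots> \<le> exp ((l / real N)\<^sup>2 * v) ^ N"
    by (rule power_mono[OF le]) (auto simp: F_def intro!: integral_nonneg_AE)
  also have "\<dots> = exp (l\<^sup>2 * v / real N)"
    using \<open>N > 0\<close> by (simp add: exp_of_nat_mult [symmetric] power2_eq_square field_simps)
  finally show "(\<integral>ds. exp (l * emp_gap M N \<phi> ds) \<partial>iid_sample N M) \<le> exp (l\<^sup>2 * v / real N)" .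
qed

text \<open>The usual bound on the expected maximum through the log-sum-exp, with the logarithm
  replaced by its tangent: y \<le> a' - 1 + exp (y - a') for y = l times the gap. Bounding the last
  exponential by the sum over \<open>J\<close> gives an explicit integrable \<open>X\<close>, so
  that neither Jensen's inequality nor a maximum over \<open>J\<close> is needed. The choice of a'
  makes exp (- a') times the expected sum at most 1.\<close>

lemma finite_class_dominated:
  fixes a v l :: real
  assumes J: "finite J" "real (card J) \<le> exp a"
    and m: "\<And>j. j \<in> J \<Longrightarrow> \<phi> j \<in> borel_measurable M"
    and b: "\<And>j x. j \<in> J \<Longrightarrow> x \<in> space M \<Longrightarrow> \<bar>\<phi> j x\<bar> \<le> 1"
    and v: "\<And>j. j \<in> J \<Longrightarrow> (\<integral>x. (\<phi> j x)\<^sup>2 \<partial>M) \<le> v"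
    and l: "0 < l" "2 * l \<le> real N" and "N > 0"
  obtains X where "integrable (iid_sample N M) X"
    and "\<And>j ds. j \<in> J \<Longrightarrow> emp_gap M N (\<phi> j) ds \<le> X ds"
    and "(\<integral>ds. X ds \<partial>iid_sample N M) \<le> a / l + l * v / real N"
proof
  interpret P: prob_space "iid_sample N M" by (rule iid_sample_prob_space)
  define a' where "a' = a + l\<^sup>2 * v / real N"
  define X where "X = (\<lambda>ds. (a' - 1 + exp (- a') * (\<Sum>j\<in>J. exp (l * emp_gap M N (\<phi> j) ds))) / l)"
  have i: "integrable (iid_sample N M) (\<lambda>ds. exp (l * emp_gap M N (\<phi> j) ds))"
    and le: "(\<integral>ds. exp (l * emp_gap M N (\<phi> j) ds) \<partial>iid_sample N M) \<le> exp (l\<^sup>2 * v / real N)"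
    if "j \<in> J" for j
    using integral_exp_emp_gap_le[OF m[OF that] b[OF that] v[OF that], of l N] l \<open>N > 0\<close> by auto
  show "integrable (iid_sample N M) X"
    unfolding X_def
    by (intro integrable_divide Bochner_Integration.integrable_add integrable_mult_right
        Bochner_Integration.integrable_sum i integrable_const) auto
  show "emp_gap M N (\<phi> j) ds \<le> X ds" if "j \<in> J" for j ds
  proof -
    have "1 + (l * emp_gap M N (\<phi> j) ds - a') \<le> exp (l * emp_gap M N (\<phi> j) ds - a')"
      by (rule exp_ge_add_one_self)
    also have "\<dots> = exp (- a') * exp (l * emp_gap M N (\<phi> j) ds)"
      by (simp add: exp_diff exp_minus field_simps)
    also have "\<dots> \<le> exp (- a') * (\<Sum>j\<in>J. exp (l * emp_gap M N (\<phi> j) ds))"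
      using J that by (intro mult_left_mono member_le_sum) auto
    finally show ?thesis using l by (simp add: X_def le_divide_eq mult.commute)
  qed
  have "(\<integral>ds. X ds \<partial>iid_sample N M) =
      (a' - 1 + exp (- a') * (\<Sum>j\<in>J. \<integral>ds. exp (l * emp_gap M N (\<phi> j) ds) \<partial>iid_sample N M)) / l"
    unfolding X_def by (simp add: i Bochner_Integration.integral_sum P.prob_space)
  also have "\<dots> \<le> (a' - 1 + exp (- a') * (\<Sum>j\<in>J. exp (l\<^sup>2 * v / real N))) / l"
    using l by (intro divide_right_mono add_left_mono mult_left_mono sum_mono le) auto
  also have "(\<Sum>j\<in>J. exp (l\<^sup>2 * v / real N)) \<le> exp a * exp (l\<^sup>2 * v / real N)"
    using J by (simp add: mult_right_mono)
  also have "(a' - 1 + exp (- a') * (exp a * exp (l\<^sup>2 * v / real N))) / l = a' / l"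
    by (simp add: a'_def exp_add [symmetric])
  also have "\<dots> = a / l + l * v / real N"
    using l \<open>N > 0\<close> by (simp add: a'_def power2_eq_square field_simps)
  finally show "(\<integral>ds. X ds \<partial>iid_sample N M) \<le> a / l + l * v / real N"
    using l by (simp add: divide_right_mono)
qed

end

section \<open>Chaining over brackets\<close>

lemma sum_linear_geometric_le:
  "(\<Sum>k<n. (2 * real k + 3) * (2 / 3) ^ k) \<le> 21"
proof -
  have "(\<Sum>k<n. (2 * real k + 3) * (2 / 3 :: real) ^ k) = 21 - (6 * real n + 21) * (2 / 3) ^ n"
    by (induction n) (auto simp: algebra_simps add_divide_distrib)
  then show ?thesis by simp
qed

lemma sum_geometric_three_quarters_le:
  "(\<Sum>k<n. (3 / 4 :: real) ^ k) \<le> 4"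
proof -
  have "(\<Sum>k<n. (3 / 4 :: real) ^ k) = 4 - 4 * (3 / 4) ^ n"
    by (induction n) (auto simp: field_simps)
  then show ?thesis by simp
qed

text \<open>\<open>K\<close> is the last level with 2^K \<le> 1 / (2 r). The first bound keeps the
  exponential moments up to level \<open>K\<close> in their admissible range; the second makes the
  bias left at level \<open>K\<close> of order r.\<close>

lemma dyadic_scale:
  fixes r :: real
  assumes "0 < r" "2 * r \<le> 1"
  obtains K :: nat where "2 * r * 2 ^ K \<le> 1" "1 / 2 ^ K \<le> 4 * r"
proof -
  obtain n :: nat where n: "1 / (2 * r) < 2 ^ n"
    using real_arch_pow[of 2 "1 / (2 * r)"] by auto
  define n0 where "n0 = (LEAST n. 1 / (2 * r) < (2 :: real) ^ n)"
  have n0: "1 / (2 * r) < 2 ^ n0" unfolding n0_def by (rule LeastI[of _ n]) (rule n)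
  have "n0 \<noteq> 0"
  proof
    assume "n0 = 0"
    with n0 show False using assms by (simp add: divide_less_eq)
  qed
  then obtain K where K: "n0 = Suc K" using not0_implies_Suc by blast
  have "\<not> 1 / (2 * r) < 2 ^ K"
    using not_less_Least[of K "\<lambda>n. 1 / (2 * r) < (2 :: real) ^ n"] K by (simp add: n0_def)
  then have "2 * r * 2 ^ K \<le> 1" using assms by (simp add: field_simps)
  moreover have "1 / 2 ^ K \<le> 4 * r" using n0 assms by (simp add: K field_simps)
  ultimately show ?thesis by (rule that)
qed

context prob_space
begin

lemma emp_gap_add:
  assumes "integrable M \<phi>" "integrable M \<psi>"
  shows "emp_gap M N (\<lambda>x. \<phi> x + \<psi> x) ds = emp_gap M N \<phi> ds + emp_gap M N \<psi> ds"
  using assms by (simp add: emp_gap_def sum.distrib add_divide_distrib)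

lemma emp_gap_diff:
  assumes "integrable M \<phi>" "integrable M \<psi>"
  shows "emp_gap M N (\<lambda>x. \<phi> x - \<psi> x) ds = emp_gap M N \<phi> ds - emp_gap M N \<psi> ds"
  using assms by (simp add: emp_gap_def sum_subtractf diff_divide_distrib)

lemma emp_gap_uminus: "emp_gap M N (\<lambda>x. - \<phi> x) ds = - emp_gap M N \<phi> ds"
  by (simp add: emp_gap_def sum_negf)

text \<open>The gap of \<phi> is at most the mean plus the empirical mean of \<open>w\<close>,
  rewritten as twice the mean minus the gap of \<open>w\<close>. Thus the residual at the last level
  is controlled by one envelope per cell, however many parameters the cell contains.\<close>

lemma emp_gap_le_envelope:
  assumes "integrable M \<phi>" "integrable M w"
    and le: "\<And>x. x \<in> space M \<Longrightarrow> \<bar>\<phi> x\<bar> \<le> w x"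
    and ds: "ds \<in> space (iid_sample N M)"
  shows "emp_gap M N \<phi> ds \<le> 2 * (\<integral>x. w x \<partial>M) + emp_gap M N (\<lambda>x. - w x) ds"
proof -
  have "(\<integral>x. \<phi> x \<partial>M) \<le> (\<integral>x. w x \<partial>M)"
    using assms by (intro integral_mono) (auto dest: order_trans[OF abs_ge_self])
  moreover have "- \<phi> (ds i) \<le> w (ds i)" if "i \<in> {1..N}" for i
    using le[OF iid_sample_component[OF ds that]] by linarith
  then have "(\<Sum>i = 1..N. - \<phi> (ds i)) \<le> (\<Sum>i = 1..N. w (ds i))"
    by (rule sum_mono)
  then have "(\<Sum>i = 1..N. - \<phi> (ds i)) / real N \<le> (\<Sum>i = 1..N. w (ds i)) / real N"
    by (rule divide_right_mono) simp
  then have "- ((\<Sum>i = 1..N. \<phi> (ds i)) / real N) \<le> (\<Sum>i = 1..N. w (ds i)) / real N"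
    by (simp add: sum_negf)
  ultimately show ?thesis by (simp add: emp_gap_uminus) (simp add: emp_gap_def)
qed

text \<open>The scales stop at the $L^1$ resolution $2^{-K} \approx r = \sqrt{\alpha/N}$. There the
  exponential moments may be taken at $\lambda_k = N r (3/2)^k \le N/2$, a range in which bounded
  variables of variance $O(2^{-k})$ behave as Gaussian ones; so the level-$k$ increments
  contribute $O(r\,(k+1)(2/3)^k + r\,(3/4)^k)$, and no factor $\log N$ arises.\<close>

lemma bracketing_chaining:
  fixes \<alpha> \<beta> :: real and f :: "'t \<Rightarrow> 'a \<Rightarrow> real" and c :: "nat \<Rightarrow> 't \<Rightarrow> 'c"
    and g w :: "nat \<Rightarrow> 'c \<Rightarrow> 'a \<Rightarrow> real"
  assumes "N > 0" and \<Theta>: "finite \<Theta>" and \<alpha>: "\<alpha> > 0" and \<beta>: "\<beta> \<ge> 0"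
    and f: "\<And>\<theta>. \<theta> \<in> \<Theta> \<Longrightarrow> f \<theta> \<in> borel_measurable M"
      "\<And>\<theta> x. \<theta> \<in> \<Theta> \<Longrightarrow> x \<in> space M \<Longrightarrow> f \<theta> x \<in> {0..1}"
    and g: "\<And>k \<theta>. \<theta> \<in> \<Theta> \<Longrightarrow> g k (c k \<theta>) \<in> borel_measurable M"
      "\<And>k \<theta> x. \<theta> \<in> \<Theta> \<Longrightarrow> x \<in> space M \<Longrightarrow> g k (c k \<theta>) x \<in> {0..1}"
    and w: "\<And>k \<theta>. \<theta> \<in> \<Theta> \<Longrightarrow> w k (c k \<theta>) \<in> borel_measurable M"
      "\<And>k \<theta> x. \<theta> \<in> \<Theta> \<Longrightarrow> x \<in> space M \<Longrightarrow> w k (c k \<theta>) x \<in> {0..1}"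
      "\<And>k \<theta>. \<theta> \<in> \<Theta> \<Longrightarrow> (\<integral>x. w k (c k \<theta>) x \<partial>M) \<le> \<beta> / 2 ^ k"
    and fg: "\<And>k \<theta> x. \<theta> \<in> \<Theta> \<Longrightarrow> x \<in> space M \<Longrightarrow> \<bar>f \<theta> x - g k (c k \<theta>) x\<bar> \<le> w k (c k \<theta>) x"
    and card: "\<And>k. real (card (c k ` \<Theta>)) \<le> exp (\<alpha> * (real k + 1))"
  obtains X where "integrable (iid_sample N M) X"
    and "\<And>\<theta> ds. \<theta> \<in> \<Theta> \<Longrightarrow> ds \<in> space (iid_sample N M) \<Longrightarrow> emp_gap M N (f \<theta>) ds \<le> X ds"
    and "(\<integral>ds. X ds \<partial>iid_sample N M) \<le> (44 + 15 * \<beta>) * sqrt (\<alpha> / real N)"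
proof -
  interpret P: prob_space "iid_sample N M" by (rule iid_sample_prob_space)
  define r where "r = sqrt (\<alpha> / real N)"
  have r: "r > 0" using \<alpha> \<open>N > 0\<close> by (simp add: r_def)
  have r2: "\<alpha> = r * r * real N" using \<alpha> \<open>N > 0\<close> by (simp add: r_def)
  have int: "integrable M (f \<theta>)" "integrable M (g k (c k \<theta>))" "integrable M (w k (c k \<theta>))"
    if "\<theta> \<in> \<Theta>" for k \<theta>
    using f[OF that] g[OF that] w(1,2)[OF that]
    by (auto intro!: integrable_bounded[where B = 1])
  show ?thesis
  proof (cases "2 * r \<le> 1")
    \<comment> \<open>So few samples that the trivial bound 1 < 2 r on the gap is good
      enough.\<close>
    case False
    show ?thesis
    proof (rule that[of "\<lambda>_. 1"])
      show "emp_gap M N (f \<theta>) ds \<le> 1" if "\<theta> \<in> \<Theta>" "ds \<in> space (iid_sample N M)" for \<theta> ds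
        using abs_emp_gap_le[of "f \<theta>" 1 ds N] f that \<open>N > 0\<close> by auto
      have "0 \<le> 15 * \<beta> * r" using \<beta> r by simp
      moreover have "1 < 2 * r" using False by simp
      ultimately have "1 \<le> (44 + 15 * \<beta>) * r" by (simp add: distrib_right)
      then show "(\<integral>ds. 1 \<partial>iid_sample N M) \<le> (44 + 15 * \<beta>) * sqrt (\<alpha> / real N)"
        by (simp add: r_def P.prob_space)
    qed auto
  next
    case True
    from dyadic_scale[OF r True]
    obtain K :: nat where K: "2 * r * 2 ^ K \<le> 1" "1 / 2 ^ K \<le> 4 * r" by blast
    \<comment> \<open>Any ratio strictly between 1 and 2 would serve: above 1 the entropy terms are
      summable, below 2 the variance terms are, since variances halve from level to level.\<close>
    define l where "l k = real N * r * (3 / 2) ^ k" for k :: nat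
    have l0: "0 < l k" for k using \<open>N > 0\<close> r by (simp add: l_def)
    have l: "2 * l k \<le> real N" if "k \<le> K" for k
    proof -
      have "(3 / 2 :: real) ^ k \<le> 2 ^ k" by (rule power_mono) auto
      also have "\<dots> \<le> 2 ^ K" using that by (intro power_increasing) auto
      finally have "2 * r * (3 / 2) ^ k \<le> 2 * r * 2 ^ K"
        using r by (intro mult_left_mono) auto
      with K have "2 * r * (3 / 2) ^ k \<le> 1" by linarith
      then have "real N * (2 * r * (3 / 2) ^ k) \<le> real N * 1" by (intro mult_left_mono) auto
      then show ?thesis by (simp add: l_def mult_ac)
    qed
    have scale: "\<alpha> * u / l k + l k * (v / 2 ^ k) / real N = r * (u * (2 / 3) ^ k) + r * (v * (3 / 4) ^ k)"
      for u v k
    proof -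
      have "\<alpha> * u / l k = r * (u * (2 / 3) ^ k)"
        using \<open>N > 0\<close> r by (simp add: l_def r2 power_divide field_simps)
      moreover have "l k * (v / 2 ^ k) / real N = r * (v * (3 / 4) ^ k)"
      proof -
        have "(3 / 4 :: real) ^ k = (3 / 2) ^ k / 2 ^ k" by (simp flip: power_divide)
        then show ?thesis using \<open>N > 0\<close> by (simp add: l_def field_simps)
      qed
      ultimately show ?thesis by simp
    qed
    \<comment> \<open>The partitions need not refine one another, so an increment is indexed by a
      pair of cells of adjacent levels; the exponents k + 1 and k + 2 add up to 2 k + 3.\<close>
    have card': "real (card ((\<lambda>\<theta>. (c k \<theta>, c (Suc k) \<theta>)) ` \<Theta>)) \<le> exp (\<alpha> * (2 * real k + 3))" for k
    proof -
      have "card ((\<lambda>\<theta>. (c k \<theta>, c (Suc k) \<theta>)) ` \<Theta>) \<le> card (c k ` \<Theta> \<times> c (Suc k) ` \<Theta>)"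
        using \<Theta> by (intro card_mono) auto
      then have "real (card ((\<lambda>\<theta>. (c k \<theta>, c (Suc k) \<theta>)) ` \<Theta>))
          \<le> real (card (c k ` \<Theta>)) * real (card (c (Suc k) ` \<Theta>))"
        by (simp add: card_cartesian_product flip: of_nat_mult)
      also have "\<dots> \<le> exp (\<alpha> * (real k + 1)) * exp (\<alpha> * (real (Suc k) + 1))"
        by (intro mult_mono card) auto
      also have "\<dots> = exp (\<alpha> * (2 * real k + 3))"
        by (simp add: exp_add [symmetric] algebra_simps)
      finally show ?thesis .
    qed

    obtain X0 where X0: "integrable (iid_sample N M) X0"
      "\<And>j ds. j \<in> c 0 ` \<Theta> \<Longrightarrow> emp_gap M N (g 0 j) ds \<le> X0 ds"
      "(\<integral>ds. X0 ds \<partial>iid_sample N M) \<le> \<alpha> / l 0 + l 0 * 1 / real N"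
    proof (rule finite_class_dominated[of "c 0 ` \<Theta>" \<alpha> "g 0" 1 "l 0" N])
      show "(\<integral>x. (g 0 j x)\<^sup>2 \<partial>M) \<le> 1" if "j \<in> c 0 ` \<Theta>" for j
        using that g(1)[of _ 0] g(2)[of _ _ 0]
        by (intro integral_le_const integrable_bounded[where B = 1]) (auto simp: power_le_one)
    qed (use \<Theta> card[of 0] g(1)[of _ 0] g(2)[of _ _ 0] l0 l[of 0] \<open>N > 0\<close> in auto)

    define Q where "Q k X \<longleftrightarrow> integrable (iid_sample N M) X \<and>
        (\<forall>\<theta>\<in>\<Theta>. \<forall>ds. emp_gap M N (\<lambda>x. g (Suc k) (c (Suc k) \<theta>) x - g k (c k \<theta>) x) ds \<le> X ds) \<and>
        (\<integral>ds. X ds \<partial>iid_sample N M) \<le>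
          r * ((2 * real k + 3) * (2 / 3) ^ k) + r * (3 / 2 * \<beta> * (3 / 4) ^ k)" for k X
    have "\<exists>X. Q k X" if k: "k < K" for k
    proof -
      let ?J = "(\<lambda>\<theta>. (c k \<theta>, c (Suc k) \<theta>)) ` \<Theta>"
      define \<phi> where "\<phi> = (\<lambda>j x. g (Suc k) (snd j) x - g k (fst j) x)"
      have lk: "2 * l k \<le> real N" using l k by simp
      have m: "\<phi> j \<in> borel_measurable M" if "j \<in> ?J" for j
        using that g(1) by (auto simp: \<phi>_def)
      have b: "\<bar>\<phi> j x\<bar> \<le> 1" if "j \<in> ?J" "x \<in> space M" for j x
      proof -
        from that obtain \<theta> where \<theta>: "\<theta> \<in> \<Theta>" "j = (c k \<theta>, c (Suc k) \<theta>)" by blast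
        show ?thesis using g(2)[OF \<theta>(1) that(2), of k] g(2)[OF \<theta>(1) that(2), of "Suc k"] \<theta>(2)
          by (auto simp: \<phi>_def)
      qed
      have v: "(\<integral>x. (\<phi> j x)\<^sup>2 \<partial>M) \<le> 3 / 2 * \<beta> / 2 ^ k" if j: "j \<in> ?J" for j
      proof -
        from that obtain \<theta> where \<theta>: "\<theta> \<in> \<Theta>" "j = (c k \<theta>, c (Suc k) \<theta>)" by blast
        \<comment> \<open>A function bounded by 1 has its square below its absolute value, and both
          approximants lie within their envelopes of the same \<open>f \<theta>\<close>. Thus the
          L^1 widths bound the second moment.\<close>
        have sq: "(\<phi> j x)\<^sup>2 \<le> w (Suc k) (c (Suc k) \<theta>) x + w k (c k \<theta>) x" if x: "x \<in> space M" for x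
        proof -
          have "(\<phi> j x)\<^sup>2 = \<bar>\<phi> j x\<bar> * \<bar>\<phi> j x\<bar>" by (simp add: power2_eq_square abs_mult_self_eq)
          also have "\<dots> \<le> \<bar>\<phi> j x\<bar> * 1" using b[OF j x] by (intro mult_left_mono) auto
          also have "\<dots> \<le> w (Suc k) (c (Suc k) \<theta>) x + w k (c k \<theta>) x"
            using fg[OF \<theta>(1) x, of k] fg[OF \<theta>(1) x, of "Suc k"] \<theta>(2) by (auto simp: \<phi>_def abs_le_iff)
          finally show ?thesis .
        qed
        have "(\<integral>x. (\<phi> j x)\<^sup>2 \<partial>M) \<le> (\<integral>x. w (Suc k) (c (Suc k) \<theta>) x + w k (c k \<theta>) x \<partial>M)"
        proof (rule integral_mono)
          show "integrable M (\<lambda>x. (\<phi> j x)\<^sup>2)"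
            using b[OF j] m[OF j]
            by (intro integrable_bounded[where B = 1]) (auto simp: abs_square_le_1)
        qed (use sq int[OF \<theta>(1)] in auto)
        also have "\<dots> = (\<integral>x. w (Suc k) (c (Suc k) \<theta>) x \<partial>M) + (\<integral>x. w k (c k \<theta>) x \<partial>M)"
          using int[OF \<theta>(1)] by simp
        also have "\<dots> \<le> \<beta> / 2 ^ Suc k + \<beta> / 2 ^ k"
          by (intro add_mono w \<theta>)
        finally show ?thesis by simp
      qed
      obtain X where X: "integrable (iid_sample N M) X"
        "\<And>j ds. j \<in> ?J \<Longrightarrow> emp_gap M N (\<phi> j) ds \<le> X ds"
        "(\<integral>ds. X ds \<partial>iid_sample N M)
          \<le> \<alpha> * (2 * real k + 3) / l k + l k * (3 / 2 * \<beta> / 2 ^ k) / real N"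
        by (rule finite_class_dominated[where \<phi> = \<phi>, OF _ card' m b v l0 lk \<open>N > 0\<close>]) (use \<Theta> in auto)
      show ?thesis
        using X unfolding scale Q_def by (intro exI[of _ X]) (auto simp: \<phi>_def)
    qed
    then obtain Y where "\<And>k. k < K \<Longrightarrow> Q k (Y k)" by metis
    then have Y: "\<And>k. k < K \<Longrightarrow> integrable (iid_sample N M) (Y k)"
      "\<And>k \<theta> ds. k < K \<Longrightarrow> \<theta> \<in> \<Theta> \<Longrightarrow>
          emp_gap M N (\<lambda>x. g (Suc k) (c (Suc k) \<theta>) x - g k (c k \<theta>) x) ds \<le> Y k ds"
      "\<And>k. k < K \<Longrightarrow> (\<integral>ds. Y k ds \<partial>iid_sample N M) \<le>
          r * ((2 * real k + 3) * (2 / 3) ^ k) + r * (3 / 2 * \<beta> * (3 / 4) ^ k)"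
      unfolding Q_def by blast+

    obtain Z where Z: "integrable (iid_sample N M) Z"
      "\<And>j ds. j \<in> c K ` \<Theta> \<Longrightarrow> emp_gap M N (\<lambda>x. - w K j x) ds \<le> Z ds"
      "(\<integral>ds. Z ds \<partial>iid_sample N M) \<le> \<alpha> * (real K + 1) / l K + l K * (\<beta> / 2 ^ K) / real N"
    proof (rule finite_class_dominated[of "c K ` \<Theta>" "\<alpha> * (real K + 1)" "\<lambda>j x. - w K j x" "\<beta> / 2 ^ K" "l K" N])
      show "(\<integral>x. (- w K j x)\<^sup>2 \<partial>M) \<le> \<beta> / 2 ^ K" if j: "j \<in> c K ` \<Theta>" for j
      proof -
        from j obtain \<theta> where \<theta>: "\<theta> \<in> \<Theta>" "j = c K \<theta>" by blast
        have "(\<integral>x. (- w K j x)\<^sup>2 \<partial>M) \<le> (\<integral>x. w K j x \<partial>M)"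
        proof (rule integral_mono)
          show "integrable M (\<lambda>x. (- w K j x)\<^sup>2)"
            using w(1)[OF \<theta>(1), of K] w(2)[OF \<theta>(1), of _ K] \<theta>(2)
            by (intro integrable_bounded[where B = 1]) (auto simp: power_le_one)
          show "(- w K j x)\<^sup>2 \<le> w K j x" if "x \<in> space M" for x
            using w(2)[OF \<theta>(1) that, of K] \<theta>(2) mult_left_le[of "w K j x" "w K j x"]
            by (auto simp: power2_eq_square)
        qed (use int \<theta> in auto)
        also have "\<dots> \<le> \<beta> / 2 ^ K" using w(3) \<theta> by simp
        finally show ?thesis .
      qed
    qed (use \<Theta> card[of K] w(1)[of _ K] w(2)[of _ _ K] l0 l[of K] \<open>N > 0\<close> in auto)

    have iY: "integrable (iid_sample N M) (\<lambda>ds. \<Sum>k<K. Y k ds)"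
      by (rule Bochner_Integration.integrable_sum) (simp add: Y(1))

    show ?thesis
    proof (rule that[of "\<lambda>ds. X0 ds + (\<Sum>k<K. Y k ds) + (Z ds + 8 * \<beta> * r)"])
      show "integrable (iid_sample N M) (\<lambda>ds. X0 ds + (\<Sum>k<K. Y k ds) + (Z ds + 8 * \<beta> * r))"
        using X0(1) Z(1) iY by simp
    next
      fix \<theta> ds assume \<theta>: "\<theta> \<in> \<Theta>" and ds: "ds \<in> space (iid_sample N M)"
      define G where "G k = emp_gap M N (g k (c k \<theta>)) ds" for k
      have "G K = G 0 + (\<Sum>k<K. G (Suc k) - G k)"
        by (simp add: sum_lessThan_telescope)
      moreover have "(\<Sum>k<K. G (Suc k) - G k) \<le> (\<Sum>k<K. Y k ds)"
        using Y(2)[OF _ \<theta>] int[OF \<theta>] by (intro sum_mono) (simp add: G_def emp_gap_diff)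
      moreover have "G 0 \<le> X0 ds" using X0(2) \<theta> by (simp add: G_def)
      ultimately have 1: "G K \<le> X0 ds + (\<Sum>k<K. Y k ds)" by linarith
      have "emp_gap M N (f \<theta>) ds - G K = emp_gap M N (\<lambda>x. f \<theta> x - g K (c K \<theta>) x) ds"
        using int[OF \<theta>] by (simp add: G_def emp_gap_diff)
      also have "\<dots> \<le> 2 * (\<integral>x. w K (c K \<theta>) x \<partial>M) + emp_gap M N (\<lambda>x. - w K (c K \<theta>) x) ds"
        using int[OF \<theta>] fg[OF \<theta>] ds by (intro emp_gap_le_envelope) auto
      also have "\<dots> \<le> 2 * (\<beta> * (4 * r)) + Z ds"
      proof (intro add_mono mult_left_mono)
        have "(\<integral>x. w K (c K \<theta>) x \<partial>M) \<le> \<beta> * (1 / 2 ^ K)" using w(3)[OF \<theta>, of K] by simp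
        also have "\<dots> \<le> \<beta> * (4 * r)" using K(2) \<beta> by (rule mult_left_mono)
        finally show "(\<integral>x. w K (c K \<theta>) x \<partial>M) \<le> \<beta> * (4 * r)" .
      qed (use Z(2) \<theta> in auto)
      finally show "emp_gap M N (f \<theta>) ds \<le> X0 ds + (\<Sum>k<K. Y k ds) + (Z ds + 8 * \<beta> * r)"
        using 1 by simp
    next
      \<comment> \<open>In units of r: the coarsest level gives 2, the increments 21 + 6 \<beta>,
        the gap of the last envelope 21 + \<beta>, and its doubled mean 8 \<beta>. The total is 44 +
        15 \<beta>.\<close>
      have "(\<integral>ds. X0 ds + (\<Sum>k<K. Y k ds) + (Z ds + 8 * \<beta> * r) \<partial>iid_sample N M) =
          (\<integral>ds. X0 ds \<partial>iid_sample N M) + (\<Sum>k<K. \<integral>ds. Y k ds \<partial>iid_sample N M)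
          + ((\<integral>ds. Z ds \<partial>iid_sample N M) + 8 * \<beta> * r)"
        using X0(1) Z(1) iY by (simp add: Bochner_Integration.integral_sum Y(1) P.prob_space)
      moreover have "(\<integral>ds. X0 ds \<partial>iid_sample N M) \<le> 2 * r"
        using X0(3) scale[of 1 0 1] by simp
      moreover have "(\<Sum>k<K. \<integral>ds. Y k ds \<partial>iid_sample N M) \<le> r * 21 + 3 / 2 * \<beta> * r * 4"
      proof -
        have "(\<Sum>k<K. \<integral>ds. Y k ds \<partial>iid_sample N M) \<le>
            (\<Sum>k<K. r * ((2 * real k + 3) * (2 / 3) ^ k) + r * (3 / 2 * \<beta> * (3 / 4) ^ k))"
          by (rule sum_mono) (use Y(3) in auto)
        also have "\<dots> = r * (\<Sum>k<K. (2 * real k + 3) * (2 / 3) ^ k)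
            + 3 / 2 * \<beta> * r * (\<Sum>k<K. (3 / 4) ^ k)"
          by (simp add: sum.distrib sum_distrib_left mult_ac)
        also have "\<dots> \<le> r * 21 + 3 / 2 * \<beta> * r * 4"
          using r \<beta> by (intro add_mono mult_left_mono sum_linear_geometric_le
              sum_geometric_three_quarters_le) auto
        finally show ?thesis .
      qed
      moreover have "(\<integral>ds. Z ds \<partial>iid_sample N M) \<le> r * 21 + r * \<beta>"
      proof -
        have "(real K + 1) * (2 / 3) ^ K \<le> (2 * real K + 3) * (2 / 3) ^ K"
          by (intro mult_right_mono) auto
        also have "\<dots> \<le> (\<Sum>k<Suc K. (2 * real k + 3) * (2 / 3) ^ k)"
          by (simp add: sum_nonneg)
        also have "\<dots> \<le> 21" by (rule sum_linear_geometric_le)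
        finally have "r * ((real K + 1) * (2 / 3) ^ K) \<le> r * 21"
          using r by (intro mult_left_mono) auto
        moreover have "r * (\<beta> * (3 / 4) ^ K) \<le> r * (\<beta> * 1)"
          using r \<beta> by (intro mult_left_mono power_le_one) auto
        ultimately show ?thesis using Z(3) unfolding scale by simp
      qed
      ultimately show "(\<integral>ds. X0 ds + (\<Sum>k<K. Y k ds) + (Z ds + 8 * \<beta> * r) \<partial>iid_sample N M)
          \<le> (44 + 15 * \<beta>) * sqrt (\<alpha> / real N)"
        by (simp add: r_def [symmetric] algebra_simps)
    qed
  qed
qed

end

section \<open>Dynamics under an (s, S) policy\<close>

text \<open>How far the inventory position lies below S after ordering. Index 0 is a dummy: the test
  \<open>t = 0\<close> gives shortfall 0 in period 1 whatever \<delta> and \<open>d 0\<close> are,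
  because the first order always fills up to S.\<close>

fun shortfall :: "real \<Rightarrow> (nat \<Rightarrow> real) \<Rightarrow> nat \<Rightarrow> real" where
  "shortfall \<delta> d 0 = 0"
| "shortfall \<delta> d (Suc t) =
     (if t = 0 \<or> \<delta> \<le> shortfall \<delta> d t + d t then 0 else shortfall \<delta> d t + d t)"

text \<open>The fixed cost of the order in period 1 is left out: whether it is incurred does not depend
  on the demand, so it cancels between risk and empirical risk. It would be discontinuous in \<open>S\<close>
  at \<open>S = x1 = 0\<close>.\<close>

definition reduced_loss ::
  "real \<Rightarrow> real \<Rightarrow> real \<Rightarrow> nat \<Rightarrow> nat \<Rightarrow> real \<Rightarrow> real \<Rightarrow> (nat \<Rightarrow> real) \<Rightarrow> real" where
  "reduced_loss h b K L T \<delta> S d =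
     ((\<Sum>t = 1..T. holding_backlog_cost h b (S - shortfall \<delta> d t - (\<Sum>j = t..t + L. d j)))
      + K * (\<Sum>t = 1..<T. of_bool (\<delta> \<le> shortfall \<delta> d t + d t \<and> 0 < shortfall \<delta> d t + d t))) / real T"

section \<open>From the inventory recursion to the shortfall recursion\<close>

definition inv_position :: "nat \<Rightarrow> real \<Rightarrow> policy \<Rightarrow> (nat \<Rightarrow> real) \<Rightarrow> nat \<Rightarrow> real" where
  "inv_position L x1 \<pi> d t = inv_level L x1 \<pi> d t + (\<Sum>t'\<in>{t - L..<t}. order_qty L x1 \<pi> d t')"

lemma order_qty_0 [simp]: "order_qty L x1 \<pi> d 0 = 0"
  by (subst order_qty.simps) simp

lemma order_qty_position:
  "t \<ge> 1 \<Longrightarrow> order_qty L x1 \<pi> d t = \<pi> t (inv_position L x1 \<pi> d t)"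
  by (subst order_qty.simps) (simp add: inv_position_def)

lemma inv_level_Suc:
  "t \<ge> 1 \<Longrightarrow> inv_level L x1 \<pi> d (Suc t) = inv_level L x1 \<pi> d t + order_qty L x1 \<pi> d (t - L) - d t"
  by (subst inv_level.simps) simp

lemma inv_position_1: "inv_position L x1 \<pi> d 1 = x1"
proof -
  have "inv_level L x1 \<pi> d 1 = x1" by (simp add: inv_level.simps)
  moreover have "(\<Sum>t'\<in>{1 - L..<1}. order_qty L x1 \<pi> d t') = 0" by (rule sum.neutral) auto
  ultimately show ?thesis by (simp add: inv_position_def)
qed

text \<open>The order that arrives is the one that leaves the pipeline. For j < L truncated
  subtraction keeps both windows starting at 0, and the arriving order is the zero order of period
  0.\<close>

lemma order_qty_window:
  assumes "j \<le> t"
  shows "order_qty L x1 \<pi> d (j - L) + (\<Sum>i = Suc j - L..t. order_qty L x1 \<pi> d i) =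
    (\<Sum>i = j - L..t. order_qty L x1 \<pi> d i)"
proof (cases "j < L")
  case True
  then have "j - L = 0" "Suc j - L = 0" by auto
  then show ?thesis by simp
next
  case False
  then have "Suc j - L = Suc (j - L)" "j - L \<le> t" using assms by auto
  then show ?thesis by (simp add: sum.atLeast_Suc_atMost)
qed

lemma inv_position_Suc:
  assumes "t \<ge> 1"
  shows "inv_position L x1 \<pi> d (Suc t) = inv_position L x1 \<pi> d t + order_qty L x1 \<pi> d t - d t"
proof -
  have "(\<Sum>i = t - L..t. order_qty L x1 \<pi> d i)
      = (\<Sum>i\<in>{t - L..<t}. order_qty L x1 \<pi> d i) + order_qty L x1 \<pi> d t"
    by (simp add: atLeastLessThanSuc_atLeastAtMost [symmetric])
  then show ?thesis
    using assms order_qty_window[of t t L x1 \<pi> d]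
    by (simp add: inv_position_def inv_level_Suc atLeastLessThanSuc_atLeastAtMost)
qed

text \<open>All that is on order after ordering in period t has arrived by period t + L, and nothing
  ordered later has. The induction on j \<le> L keeps the sum of the level in period t + j and of
  those orders placed up to period t that arrive in period t + j or later; only demand changes
  it.\<close>

lemma level_after_replenishment_position:
  assumes "t \<ge> 1"
  shows "level_after_replenishment L x1 \<pi> d (t + L) =
    inv_position L x1 \<pi> d t + order_qty L x1 \<pi> d t - (\<Sum>j\<in>{t..<t + L}. d j)"
proof -
  have "inv_level L x1 \<pi> d (t + j) + (\<Sum>i = t + j - L..t. order_qty L x1 \<pi> d i) =
      inv_position L x1 \<pi> d t + order_qty L x1 \<pi> d t - (\<Sum>i\<in>{t..<t + j}. d i)" if "j \<le> L" for j
    using that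
  proof (induction j)
    case 0
    then show ?case
      by (simp add: inv_position_def atLeastLessThanSuc_atLeastAtMost [symmetric])
  next
    case (Suc j)
    have "order_qty L x1 \<pi> d (t + j - L) + (\<Sum>i = Suc (t + j) - L..t. order_qty L x1 \<pi> d i) =
        (\<Sum>i = t + j - L..t. order_qty L x1 \<pi> d i)"
    proof (cases "t + j - L = 0 \<and> Suc (t + j) - L = 0")
      case False
      then have "Suc (t + j) - L = Suc (t + j - L)" "t + j - L \<le> t" using Suc.prems by auto
      then show ?thesis by (simp add: sum.atLeast_Suc_atMost)
    qed simp
    with Suc show ?case using assms by (simp add: inv_level_Suc)
  qed
  from this[of L] show ?thesis by (simp add: level_after_replenishment_def)
qed

text \<open>The position before ordering in period t + 1 is S minus shortfall minus demand, so the
  test against s turns into a test of shortfall plus demand against S - s, in which S no longer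
  occurs by itself.\<close>

lemma position_after_order:
  assumes first: "b = 0 \<or> x1 \<le> s" and "t \<ge> 1"
  shows "inv_position L x1 (sS_policy b (s, S)) d t + order_qty L x1 (sS_policy b (s, S)) d t =
    S - shortfall (S - s) d t"
  using \<open>t \<ge> 1\<close>
proof (induction t rule: nat_induct_at_least)
  case base
  have "order_qty L x1 (sS_policy b (s, S)) d 1 = S - x1"
    using first inv_position_1[of L x1 "sS_policy b (s, S)" d]
    by (auto simp: order_qty_position sS_policy_def)
  then show ?case using inv_position_1[of L x1 "sS_policy b (s, S)" d] by simp
next
  case (Suc t)
  then show ?case by (auto simp: order_qty_position inv_position_Suc sS_policy_def)
qed

lemma order_qty_1:
  assumes "b = 0 \<or> x1 \<le> s"
  shows "order_qty L x1 (sS_policy b (s, S)) d 1 = S - x1"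
  using assms inv_position_1[of L x1 "sS_policy b (s, S)" d]
  by (auto simp: order_qty_position sS_policy_def)

lemma order_qty_Suc:
  assumes "b = 0 \<or> x1 \<le> s" and "t \<ge> 1"
  shows "order_qty L x1 (sS_policy b (s, S)) d (Suc t) =
    (shortfall (S - s) d t + d t) * of_bool (S - s \<le> shortfall (S - s) d t + d t)"
proof -
  have "inv_position L x1 (sS_policy b (s, S)) d (Suc t) = S - (shortfall (S - s) d t + d t)"
    using position_after_order[OF assms, of L S d] assms(2) by (simp add: inv_position_Suc)
  then show ?thesis using assms(2) by (auto simp: order_qty_position sS_policy_def)
qed

lemma sS_loss_eq:
  assumes first: "b = 0 \<or> x1 \<le> s" and "T \<ge> 1"
  shows "sS_loss h b K L T x1 (s, S) d =
    reduced_loss h b K L T (S - s) S d + K / real T * of_bool (x1 < S)"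
proof -
  let ?\<pi> = "sS_policy b (s, S)"
  have level: "level_after_replenishment L x1 ?\<pi> d (t + L) - d (t + L) =
      S - shortfall (S - s) d t - (\<Sum>j = t..t + L. d j)" if "t \<ge> 1" for t
  proof -
    have "(\<Sum>j = t..t + L. d j) = (\<Sum>j\<in>{t..<t + L}. d j) + d (t + L)"
      by (simp add: atLeastLessThanSuc_atLeastAtMost [symmetric])
    then show ?thesis
      using level_after_replenishment_position[OF that, of L x1 ?\<pi> d]
        position_after_order[OF first that, of L S d] by simp
  qed
  \<comment> \<open>The first order is split off, so the remaining T - 1 are indexed by the period
    whose demand triggers them. With s = S and no demand an order of size zero is triggered, which
    carries no fixed cost; hence the strict inequality.\<close>
  have orders: "(\<Sum>t = 1..T. of_bool (order_qty L x1 ?\<pi> d t > 0)) = of_bool (x1 < S)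
      + (\<Sum>t = 1..<T. of_bool (S - s \<le> shortfall (S - s) d t + d t \<and> 0 < shortfall (S - s) d t + d t) :: real)"
  proof -
    have "(\<Sum>t = 1..T. of_bool (order_qty L x1 ?\<pi> d t > 0) :: real) =
        of_bool (order_qty L x1 ?\<pi> d 1 > 0) + (\<Sum>t = Suc 1..<Suc T. of_bool (order_qty L x1 ?\<pi> d t > 0))"
      unfolding atLeastLessThanSuc_atLeastAtMost using \<open>T \<ge> 1\<close> by (rule sum.atLeast_Suc_atMost)
    also have "(\<Sum>t = Suc 1..<Suc T. of_bool (order_qty L x1 ?\<pi> d t > 0) :: real) =
        (\<Sum>t = 1..<T. of_bool (order_qty L x1 ?\<pi> d (Suc t) > 0))"
      by (rule sum.shift_bounds_Suc_ivl)
    also have "\<dots> = (\<Sum>t = 1..<T. of_bool (S - s \<le> shortfall (S - s) d t + d t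
        \<and> 0 < shortfall (S - s) d t + d t))"
      by (rule sum.cong) (auto simp: order_qty_Suc[OF first])
    finally show ?thesis using order_qty_1[OF first, of L S d] by simp
  qed
  have "(\<Sum>t = L + 1..T + L. period_loss h b K L x1 ?\<pi> d t) =
      (\<Sum>t = 1..T. period_loss h b K L x1 ?\<pi> d (t + L))"
    using sum.shift_bounds_cl_nat_ivl[of "period_loss h b K L x1 ?\<pi> d" 1 L T] by (simp add: add.commute)
  also have "\<dots> = (\<Sum>t = 1..T. holding_backlog_cost h b (S - shortfall (S - s) d t - (\<Sum>j = t..t + L. d j)))
      + K * (\<Sum>t = 1..T. of_bool (order_qty L x1 ?\<pi> d t > 0))"
    by (simp add: period_loss_def level sum.distrib sum_distrib_left)
  finally show ?thesis
    unfolding orders by (simp add: sS_loss_def policy_loss_def reduced_loss_def distrib_left add_divide_distrib)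
qed

section \<open>Dependence on the threshold through interval demands\<close>

lemma shortfall_eq_interval_sum:
  "t \<ge> 1 \<Longrightarrow> \<exists>i\<in>{1..t}. shortfall \<delta> d t = (\<Sum>j = i..<t. d j)"
proof (induction t rule: nat_induct_at_least)
  case (Suc t)
  then obtain i where i: "i \<in> {1..t}" "shortfall \<delta> d t = (\<Sum>j = i..<t. d j)" by blast
  show ?case
  proof (cases "shortfall \<delta> d (Suc t) = 0")
    case True
    then show ?thesis by (intro bexI[of _ "Suc t"]) auto
  next
    case False
    then show ?thesis using i by (intro bexI[of _ i]) (auto split: if_splits)
  qed
qed auto

lemma shortfall_nonneg:
  assumes "\<And>i. i \<in> {1..<t} \<Longrightarrow> 0 \<le> d i"
  shows "0 \<le> shortfall \<delta> d t"
proof (cases "t \<ge> 1")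
  case True
  from shortfall_eq_interval_sum[OF this, of \<delta> d]
  obtain i where "i \<in> {1..t}" "shortfall \<delta> d t = (\<Sum>j = i..<t. d j)" by blast
  then show ?thesis using assms by (auto intro!: sum_nonneg)
next
  case False
  then show ?thesis by (cases t) auto
qed

lemma shortfall_le: "0 \<le> \<delta> \<Longrightarrow> shortfall \<delta> d t \<le> \<delta>"
  by (cases t) auto

text \<open>A counting function of the interval demands, with strict inequality to match the order
  test and thus left continuous in \<delta>. Pairs with i > j contribute the empty sum 0, that is,
  merely a further jump at \<delta> = 0.\<close>

definition interval_count :: "nat \<Rightarrow> (nat \<Rightarrow> real) \<Rightarrow> real \<Rightarrow> real" where
  "interval_count T d \<delta> = (\<Sum>(i, j)\<in>{1..T} \<times> {1..T}. of_bool ((\<Sum>k = i..j. d k) < \<delta>))"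

lemma interval_count_mono: "\<delta> \<le> \<delta>' \<Longrightarrow> interval_count T d \<delta> \<le> interval_count T d \<delta>'"
  unfolding interval_count_def by (rule sum_mono) auto

lemma interval_count_bounds: "interval_count T d \<delta> \<in> {0..(real T)\<^sup>2}"
proof -
  have "interval_count T d \<delta> \<le> (\<Sum>(i, j)\<in>{1..T} \<times> {1..T}. 1)"
    unfolding interval_count_def by (rule sum_mono) auto
  moreover have "0 \<le> interval_count T d \<delta>"
    unfolding interval_count_def by (rule sum_nonneg) auto
  ultimately show ?thesis by (simp add: power2_eq_square case_prod_unfold)
qed

lemma interval_count_step:
  assumes "\<delta> \<le> \<delta>'" and ij: "i \<in> {1..T}" "j \<in> {1..T}"
    and w: "\<delta> \<le> (\<Sum>k = i..j. d k)" "(\<Sum>k = i..j. d k) < \<delta>'"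
  shows "interval_count T d \<delta> + 1 \<le> interval_count T d \<delta>'"
proof -
  let ?g = "\<lambda>(i, j). of_bool ((\<Sum>k = i..j. d k) < \<delta>') - of_bool ((\<Sum>k = i..j. d k) < \<delta>) :: real"
  have "?g (i, j) \<le> sum ?g ({1..T} \<times> {1..T})"
    by (rule member_le_sum) (use assms in auto)
  then show ?thesis
    using w by (simp add: interval_count_def case_prod_unfold sum_subtractf)
qed

text \<open>Equal counts mean that no interval demand lies in [\<delta>, \<delta>'). As each
  shortfall is the demand of an interval ending just before the current period, each test compares
  the threshold with an interval demand. Hence the decisions agree period by period.\<close>

lemma order_test_cong:
  assumes "\<delta> \<le> \<delta>'" and eq: "interval_count T d \<delta> = interval_count T d \<delta>'"
    and "t \<ge> 1" "t \<le> T"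
  shows "shortfall \<delta> d t = shortfall \<delta>' d t"
    and "\<delta> \<le> shortfall \<delta> d t + d t \<longleftrightarrow> \<delta>' \<le> shortfall \<delta>' d t + d t"
proof -
  have test: "\<delta> \<le> shortfall \<delta>' d t + d t \<longleftrightarrow> \<delta>' \<le> shortfall \<delta>' d t + d t" if "t \<ge> 1" "t \<le> T" for t
  proof -
    from shortfall_eq_interval_sum[OF that(1), of \<delta>' d]
    obtain i where i: "i \<in> {1..t}" "shortfall \<delta>' d t = (\<Sum>j = i..<t. d j)" by blast
    then have w: "shortfall \<delta>' d t + d t = (\<Sum>j = i..t. d j)"
      by (simp add: atLeastLessThanSuc_atLeastAtMost [symmetric])
    have "\<not> (\<delta> \<le> (\<Sum>j = i..t. d j) \<and> (\<Sum>j = i..t. d j) < \<delta>')"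
      using interval_count_step[OF assms(1), of i T t d] i that eq by auto
    then show ?thesis using w \<open>\<delta> \<le> \<delta>'\<close> by auto
  qed
  show *: "shortfall \<delta> d t = shortfall \<delta>' d t"
    using \<open>t \<ge> 1\<close> \<open>t \<le> T\<close>
  proof (induction t rule: nat_induct_at_least)
    case (Suc t)
    then show ?case using test[of t] by simp
  qed simp
  show "\<delta> \<le> shortfall \<delta> d t + d t \<longleftrightarrow> \<delta>' \<le> shortfall \<delta>' d t + d t"
    unfolding * by (rule test) (use assms in auto)
qed

lemma reduced_loss_cong:
  assumes "\<delta> \<le> \<delta>'" "interval_count T d \<delta> = interval_count T d \<delta>'"
  shows "reduced_loss h b K L T \<delta> S d = reduced_loss h b K L T \<delta>' S d"
proof -
  have "(\<Sum>t = 1..T. holding_backlog_cost h b (S - shortfall \<delta> d t - (\<Sum>j = t..t + L. d j))) =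
      (\<Sum>t = 1..T. holding_backlog_cost h b (S - shortfall \<delta>' d t - (\<Sum>j = t..t + L. d j)))"
    using order_test_cong[OF assms] by (intro sum.cong) auto
  moreover have "(\<Sum>t = 1..<T. of_bool (\<delta> \<le> shortfall \<delta> d t + d t \<and> 0 < shortfall \<delta> d t + d t) :: real) =
      (\<Sum>t = 1..<T. of_bool (\<delta>' \<le> shortfall \<delta>' d t + d t \<and> 0 < shortfall \<delta>' d t + d t))"
    using order_test_cong[OF assms] by (intro sum.cong) auto
  ultimately show ?thesis unfolding reduced_loss_def by simp
qed

text \<open>Integrality turns the event that the count changes into the linear bound 1 \<le>
  increment, whose expectation is an increment of the mean count. This makes cells of the mean count
  into L^1 brackets.\<close>

lemma interval_count_less:
  assumes "\<delta> \<le> \<delta>'" "interval_count T d \<delta> \<noteq> interval_count T d \<delta>'"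
  shows "interval_count T d \<delta> + 1 \<le> interval_count T d \<delta>'"
proof -
  have "\<exists>i\<in>{1..T}. \<exists>j\<in>{1..T}. \<delta> \<le> (\<Sum>k = i..j. d k) \<and> (\<Sum>k = i..j. d k) < \<delta>'"
  proof (rule ccontr)
    assume "\<not> ?thesis"
    then have "interval_count T d \<delta> = interval_count T d \<delta>'"
      unfolding interval_count_def using \<open>\<delta> \<le> \<delta>'\<close>
      by (intro sum.cong) (force intro: arg_cong[of _ _ of_bool])+
    with assms show False by simp
  qed
  then show ?thesis using interval_count_step[OF assms(1)] by blast
qed

text \<open>A monotone function of the level whose increments dominate those of the cost.\<close>

definition signed_cost :: "real \<Rightarrow> real \<Rightarrow> real \<Rightarrow> real" where
  "signed_cost h b x = h * max x 0 - b * max (- x) 0"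

definition mean_signed_cost ::
  "real \<Rightarrow> real \<Rightarrow> nat \<Rightarrow> nat \<Rightarrow> real \<Rightarrow> real \<Rightarrow> (nat \<Rightarrow> real) \<Rightarrow> real" where
  "mean_signed_cost h b L T \<delta> S d =
     (\<Sum>t = 1..T. signed_cost h b (S - shortfall \<delta> d t - (\<Sum>j = t..t + L. d j))) / real T"

lemma signed_cost_mono:
  assumes "0 \<le> h" "0 \<le> b" "x \<le> y"
  shows "signed_cost h b x \<le> signed_cost h b y"
  unfolding signed_cost_def using assms by (intro diff_mono mult_left_mono) auto

text \<open>The holding part increases and the backlog part decreases in the level. The cost lets
  their increments cancel, while the signed cost adds their absolute values.\<close>

lemma holding_backlog_cost_diff_le:
  assumes "0 \<le> h" "0 \<le> b" "x \<le> y"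
  shows "\<bar>holding_backlog_cost h b y - holding_backlog_cost h b x\<bar> \<le> signed_cost h b y - signed_cost h b x"
proof -
  have "h * max x 0 \<le> h * max y 0" "b * max (- y) 0 \<le> b * max (- x) 0"
    using assms by (auto intro!: mult_left_mono)
  then show ?thesis unfolding holding_backlog_cost_def signed_cost_def by linarith
qed

lemma mean_signed_cost_mono:
  assumes "0 \<le> h" "0 \<le> b" "S \<le> S'"
  shows "mean_signed_cost h b L T \<delta> S d \<le> mean_signed_cost h b L T \<delta> S' d"
  unfolding mean_signed_cost_def using assms
  by (intro divide_right_mono sum_mono signed_cost_mono) auto

lemma reduced_loss_diff_le:
  assumes "0 \<le> h" "0 \<le> b" "S \<le> S'"
  shows "\<bar>reduced_loss h b K L T \<delta> S' d - reduced_loss h b K L T \<delta> S d\<bar>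
    \<le> mean_signed_cost h b L T \<delta> S' d - mean_signed_cost h b L T \<delta> S d"
proof -
  let ?x = "\<lambda>S t. S - shortfall \<delta> d t - (\<Sum>j = t..t + L. d j)"
  have "\<bar>\<Sum>t = 1..T. holding_backlog_cost h b (?x S' t) - holding_backlog_cost h b (?x S t)\<bar>
      \<le> (\<Sum>t = 1..T. \<bar>holding_backlog_cost h b (?x S' t) - holding_backlog_cost h b (?x S t)\<bar>)"
    by (rule sum_abs)
  also have "\<dots> \<le> (\<Sum>t = 1..T. signed_cost h b (?x S' t) - signed_cost h b (?x S t))"
    using assms by (intro sum_mono holding_backlog_cost_diff_le) auto
  finally have "\<bar>\<Sum>t = 1..T. holding_backlog_cost h b (?x S' t) - holding_backlog_cost h b (?x S t)\<bar> / real T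
      \<le> (\<Sum>t = 1..T. signed_cost h b (?x S' t) - signed_cost h b (?x S t)) / real T"
    by (rule divide_right_mono) simp
  then show ?thesis
    by (simp add: reduced_loss_def mean_signed_cost_def sum_subtractf flip: diff_divide_distrib)
qed

lemma demand_window_bounds:
  assumes d: "\<And>i. i \<in> {1..T + L} \<Longrightarrow> d i \<in> {0..U}" and t: "t \<in> {1..T}"
  shows "(\<Sum>j = t..t + L. d j) \<in> {0..(real L + 1) * U}"
proof -
  have "(\<Sum>j = t..t + L. d j) \<le> (\<Sum>j = t..t + L. U)"
    using d t by (intro sum_mono) auto
  moreover have "0 \<le> (\<Sum>j = t..t + L. d j)"
    using d t by (intro sum_nonneg) auto
  ultimately show ?thesis by (simp add: algebra_simps)
qed

text \<open>This is what the limits of the class are made for: S \<le> (L + 1) U / h caps the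
  holding term, and s - (L + 1) U \<ge> - (L + 1) U / b caps the backlog term. Where a limit is
  infinite, the coefficient is zero and so is the term.\<close>

lemma cost_terms_bounds:
  assumes p: "(s, S) \<in> sS_class h b L U" and "0 \<le> h" "0 \<le> b" "U > 0"
    and x: "s - (real L + 1) * U \<le> x" "x \<le> S"
  shows "h * max x 0 \<in> {0..(real L + 1) * U}" and "b * max (- x) 0 \<in> {0..(real L + 1) * U}"
proof -
  define M where "M = (real L + 1) * U"
  have M: "0 \<le> M" using \<open>U > 0\<close> by (simp add: M_def)
  have "h * max x 0 \<le> M"
  proof (cases "h = 0")
    case False
    then have "S \<le> M / h" "0 \<le> S" using p by (auto simp: sS_class_def H_upper_def M_def)
    then have "max x 0 \<le> M / h" using x by auto
    then have "h * max x 0 \<le> h * (M / h)" using \<open>0 \<le> h\<close> by (intro mult_left_mono) auto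
    then show ?thesis using False by simp
  qed (use M in simp)
  then show "h * max x 0 \<in> {0..(real L + 1) * U}" using \<open>0 \<le> h\<close> by (simp add: M_def)
  have "b * max (- x) 0 \<le> M"
  proof (cases "b = 0 \<or> 0 \<le> x")
    case False
    then have "M * (1 - 1 / b) \<le> s" using p by (auto simp: sS_class_def H_lower_def M_def)
    then have "- x \<le> M - M * (1 - 1 / b)" using x by (simp add: M_def)
    then have "b * (- x) \<le> b * (M - M * (1 - 1 / b))" using \<open>0 \<le> b\<close> by (intro mult_left_mono) auto
    also have "\<dots> = M" using False by (simp add: field_simps)
    finally show ?thesis using False by simp
  qed (use M in auto)
  then show "b * max (- x) 0 \<in> {0..(real L + 1) * U}" using \<open>0 \<le> b\<close> by (simp add: M_def)
qed

lemma level_bounds: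
  assumes p: "(S - \<delta>, S) \<in> sS_class h b L U"
    and d: "\<And>i. i \<in> {1..T + L} \<Longrightarrow> d i \<in> {0..U}" and t: "t \<in> {1..T}"
  shows "S - \<delta> - (real L + 1) * U \<le> S - shortfall \<delta> d t - (\<Sum>j = t..t + L. d j)"
    and "S - shortfall \<delta> d t - (\<Sum>j = t..t + L. d j) \<le> S"
proof -
  have "0 \<le> \<delta>" using p by (auto simp: sS_class_def)
  then have "shortfall \<delta> d t \<le> \<delta>" by (rule shortfall_le)
  moreover have "0 \<le> shortfall \<delta> d t" by (rule shortfall_nonneg) (use d t in auto)
  ultimately show "S - \<delta> - (real L + 1) * U \<le> S - shortfall \<delta> d t - (\<Sum>j = t..t + L. d j)"
    and "S - shortfall \<delta> d t - (\<Sum>j = t..t + L. d j) \<le> S"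
    using demand_window_bounds[of T L d U t, OF d t] by auto
qed

lemma mean_bounds:
  fixes f :: "nat \<Rightarrow> real"
  assumes "\<And>t. t \<in> {1..T} \<Longrightarrow> f t \<in> {l..u}" "T \<ge> 1"
  shows "(\<Sum>t = 1..T. f t) / real T \<in> {l..u}"
proof -
  have "(\<Sum>t = 1..T. l) \<le> (\<Sum>t = 1..T. f t)" by (rule sum_mono) (use assms in auto)
  moreover have "(\<Sum>t = 1..T. f t) \<le> (\<Sum>t = 1..T. u)" by (rule sum_mono) (use assms in auto)
  ultimately show ?thesis using \<open>T \<ge> 1\<close> by (simp add: divide_simps mult.commute)
qed

lemma mean_signed_cost_bounds:
  assumes p: "(S - \<delta>, S) \<in> sS_class h b L U" and hb: "0 \<le> h" "0 \<le> b" "U > 0" and "T \<ge> 1"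
    and d: "\<And>i. i \<in> {1..T + L} \<Longrightarrow> d i \<in> {0..U}"
  shows "mean_signed_cost h b L T \<delta> S d \<in> {- ((real L + 1) * U)..(real L + 1) * U}"
  unfolding mean_signed_cost_def
proof (rule mean_bounds)
  fix t assume t: "t \<in> {1..T}"
  show "signed_cost h b (S - shortfall \<delta> d t - (\<Sum>j = t..t + L. d j))
      \<in> {- ((real L + 1) * U)..(real L + 1) * U}"
    using cost_terms_bounds[OF p hb level_bounds[where d = d, OF p d t]] by (simp add: signed_cost_def)
qed (rule \<open>T \<ge> 1\<close>)

lemma reduced_loss_bounds:
  assumes p: "(S - \<delta>, S) \<in> sS_class h b L U" and hb: "0 \<le> h" "0 \<le> b" "U > 0"
    and "K \<ge> 0" "T \<ge> 1"
    and d: "\<And>i. i \<in> {1..T + L} \<Longrightarrow> d i \<in> {0..U}"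
  shows "reduced_loss h b K L T \<delta> S d \<in> {0..(real L + 1) * U + K}"
proof -
  let ?x = "\<lambda>t. S - shortfall \<delta> d t - (\<Sum>j = t..t + L. d j)"
  let ?o = "\<Sum>t = 1..<T. of_bool (\<delta> \<le> shortfall \<delta> d t + d t \<and> 0 < shortfall \<delta> d t + d t) :: real"
  have "(\<Sum>t = 1..T. holding_backlog_cost h b (?x t)) / real T \<in> {0..(real L + 1) * U}"
  proof (rule mean_bounds)
    fix t assume t: "t \<in> {1..T}"
    show "holding_backlog_cost h b (?x t) \<in> {0..(real L + 1) * U}"
      using cost_terms_bounds[OF p hb level_bounds[where d = d, OF p d t]]
      by (cases "0 \<le> ?x t") (auto simp: holding_backlog_cost_def max_def)
  qed (rule \<open>T \<ge> 1\<close>)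
  moreover have "?o \<le> (\<Sum>t = 1..<T. 1)" by (rule sum_mono) auto
  then have "?o / real T \<le> 1" using \<open>T \<ge> 1\<close> by (simp add: divide_le_eq)
  then have "K * (?o / real T) \<le> K * 1" using \<open>K \<ge> 0\<close> by (rule mult_left_mono)
  moreover have "0 \<le> K * (?o / real T)" using \<open>K \<ge> 0\<close> by (simp add: sum_nonneg)
  ultimately show ?thesis unfolding reduced_loss_def add_divide_distrib by simp
qed

section \<open>Measurability in the demand, and continuity in the parameters\<close>

lemma demand_component_measurable:
  assumes "i \<in> {1..n}"
  shows "(\<lambda>d. d i) \<in> borel_measurable (demand_space n U)"
  using measurable_component_singleton[OF assms, of "\<lambda>_. restrict_space borel {0..U}"]
  by (simp add: demand_space_def measurable_restrict_space2_iff)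

lemma space_demand_space_bounds:
  "d \<in> space (demand_space n U) \<Longrightarrow> i \<in> {1..n} \<Longrightarrow> d i \<in> {0..U}"
  by (auto simp: demand_space_def space_PiM space_restrict_space)

lemma demand_sum_measurable:
  assumes "A \<subseteq> {1..n}"
  shows "(\<lambda>d. \<Sum>i\<in>A. d i) \<in> borel_measurable (demand_space n U)"
  using assms by (intro borel_measurable_sum demand_component_measurable) auto

lemma shortfall_measurable:
  "t \<le> n \<Longrightarrow> (\<lambda>d. shortfall \<delta> d t) \<in> borel_measurable (demand_space n U)"
proof (induction t)
  case (Suc t)
  show ?case
  proof (cases "t = 0")
    case False
    then have [measurable]: "(\<lambda>d. d t) \<in> borel_measurable (demand_space n U)"
        "(\<lambda>d. shortfall \<delta> d t) \<in> borel_measurable (demand_space n U)"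
      using Suc by (auto intro!: demand_component_measurable)
    show ?thesis using False by simp
  qed simp
qed simp

lemma reduced_loss_measurable:
  "(\<lambda>d. reduced_loss h b K L T \<delta> S d) \<in> borel_measurable (demand_space (T + L) U)"
proof -
  have 1: "(\<lambda>d. holding_backlog_cost h b (S - shortfall \<delta> d t - (\<Sum>j = t..t + L. d j)))
      \<in> borel_measurable (demand_space (T + L) U)" if "t \<in> {1..T}" for t
  proof -
    have [measurable]: "(\<lambda>d. \<Sum>j = t..t + L. d j) \<in> borel_measurable (demand_space (T + L) U)"
        "(\<lambda>d. shortfall \<delta> d t) \<in> borel_measurable (demand_space (T + L) U)"
      using that by (auto intro!: demand_sum_measurable shortfall_measurable)
    show ?thesis unfolding holding_backlog_cost_def by measurable
  qed
  have 2: "(\<lambda>d. of_bool (\<delta> \<le> shortfall \<delta> d t + d t \<and> 0 < shortfall \<delta> d t + d t) :: real)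
      \<in> borel_measurable (demand_space (T + L) U)" if "t \<in> {1..<T}" for t
  proof -
    have [measurable]: "(\<lambda>d. d t) \<in> borel_measurable (demand_space (T + L) U)"
        "(\<lambda>d. shortfall \<delta> d t) \<in> borel_measurable (demand_space (T + L) U)"
      using that by (auto intro!: demand_component_measurable shortfall_measurable)
    show ?thesis by measurable
  qed
  show ?thesis
    unfolding reduced_loss_def using 1 2
    by (intro borel_measurable_divide borel_measurable_add borel_measurable_times
        borel_measurable_sum borel_measurable_const) auto
qed

lemma mean_signed_cost_measurable:
  "(\<lambda>d. mean_signed_cost h b L T \<delta> S d) \<in> borel_measurable (demand_space (T + L) U)"
proof -
  have 1: "(\<lambda>d. signed_cost h b (S - shortfall \<delta> d t - (\<Sum>j = t..t + L. d j)))
      \<in> borel_measurable (demand_space (T + L) U)" if "t \<in> {1..T}" for t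
  proof -
    have [measurable]: "(\<lambda>d. \<Sum>j = t..t + L. d j) \<in> borel_measurable (demand_space (T + L) U)"
        "(\<lambda>d. shortfall \<delta> d t) \<in> borel_measurable (demand_space (T + L) U)"
      using that by (auto intro!: demand_sum_measurable shortfall_measurable)
    show ?thesis unfolding signed_cost_def by measurable
  qed
  show ?thesis
    unfolding mean_signed_cost_def using 1
    by (intro borel_measurable_divide borel_measurable_sum borel_measurable_const) auto
qed

lemma interval_count_measurable:
  "(\<lambda>d. interval_count T d \<delta>) \<in> borel_measurable (demand_space (T + L) U)"
proof -
  have "(\<lambda>d. of_bool ((\<Sum>k = fst p..snd p. d k) < \<delta>) :: real)
      \<in> borel_measurable (demand_space (T + L) U)" if "p \<in> {1..T} \<times> {1..T}" for p
  proof -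
    have [measurable]: "(\<lambda>d. \<Sum>k = fst p..snd p. d k) \<in> borel_measurable (demand_space (T + L) U)"
      using that by (intro demand_sum_measurable) auto
    show ?thesis by measurable
  qed
  then show ?thesis
    unfolding interval_count_def case_prod_unfold by (rule borel_measurable_sum)
qed

text \<open>Left continuity in \<open>\<delta>\<close>: an order is triggered by the non-strict inequality
  \<open>\<delta> \<le> shortfall + demand\<close>.\<close>

lemma reduced_loss_tendsto:
  assumes \<delta>: "\<And>n. \<delta>' n \<le> \<delta>" "\<delta>' \<longlonglongrightarrow> \<delta>" and S: "S' \<longlonglongrightarrow> S"
  shows "(\<lambda>n. reduced_loss h b K L T (\<delta>' n) (S' n) d) \<longlonglongrightarrow> reduced_loss h b K L T \<delta> S d"
proof -
  \<comment> \<open>There are finitely many interval demands. One below \<delta> is eventually below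
    \<open>\<delta>' n\<close>; one at or above \<delta> never is, as \<open>\<delta>' n\<close>
    stays at or below \<delta>. So the counts eventually agree and only the continuous dependence on
    S remains.\<close>
  have "eventually (\<lambda>n. \<forall>p\<in>{1..T} \<times> {1..T}. (\<Sum>k = fst p..snd p. d k) < \<delta>' n
      \<longleftrightarrow> (\<Sum>k = fst p..snd p. d k) < \<delta>) sequentially"
  proof (intro eventually_ball_finite ballI)
    fix p assume "p \<in> {1..T} \<times> {1..T}"
    show "eventually (\<lambda>n. (\<Sum>k = fst p..snd p. d k) < \<delta>' n
      \<longleftrightarrow> (\<Sum>k = fst p..snd p. d k) < \<delta>) sequentially"
    proof (cases "(\<Sum>k = fst p..snd p. d k) < \<delta>")
      case True
      then show ?thesis using order_tendstoD(1)[OF \<delta>(2) True] by simp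
    next
      case False
      then have "\<not> (\<Sum>k = fst p..snd p. d k) < \<delta>' n" for n using \<delta>(1)[of n] by simp
      then show ?thesis using False by simp
    qed
  qed simp
  then have "eventually (\<lambda>n. interval_count T d (\<delta>' n) = interval_count T d \<delta>) sequentially"
    by eventually_elim (unfold interval_count_def, rule sum.cong, auto)
  then have ev: "eventually (\<lambda>n. reduced_loss h b K L T \<delta> (S' n) d =
      reduced_loss h b K L T (\<delta>' n) (S' n) d) sequentially"
    by eventually_elim (rule reduced_loss_cong[symmetric, OF \<delta>(1)])
  have "(\<lambda>n. reduced_loss h b K L T \<delta> (S' n) d) \<longlonglongrightarrow> reduced_loss h b K L T \<delta> S d"
    unfolding reduced_loss_def holding_backlog_cost_def divide_inverse by (intro tendsto_intros S)
  then show ?thesis using ev by (rule Lim_transform_eventually)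
qed

section \<open>Brackets for the losses of (s, S) policies\<close>

lemma abs_diff_less_of_nat_floor_eq:
  fixes x y :: real
  assumes "0 \<le> x" "0 \<le> y" "nat \<lfloor>x\<rfloor> = nat \<lfloor>y\<rfloor>"
  shows "\<bar>x - y\<bar> < 1"
proof -
  have "\<lfloor>x\<rfloor> = \<lfloor>y\<rfloor>" using assms by (simp add: eq_nat_nat_iff)
  then show ?thesis by linarith
qed

text \<open>Maxima over initial segments of an enumeration increase to the supremum, which makes it
  measurable; the common bound \<open>B\<close> lets their integrals converge. The dominating
  \<open>Y\<close> may differ from one finite set to another, since only the bound c on its integral
  is carried to the limit.\<close>

lemma (in prob_space) countable_SUP_integral_le:
  fixes X :: "'q \<Rightarrow> 'a \<Rightarrow> real"
  assumes Q: "countable Q" "Q \<noteq> {}"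
    and X: "\<And>q. q \<in> Q \<Longrightarrow> X q \<in> borel_measurable M"
      "\<And>q x. q \<in> Q \<Longrightarrow> x \<in> space M \<Longrightarrow> \<bar>X q x\<bar> \<le> B"
    and finite: "\<And>F. finite F \<Longrightarrow> F \<subseteq> Q \<Longrightarrow>
      \<exists>Y. integrable M Y \<and> (\<forall>q\<in>F. \<forall>x\<in>space M. X q x \<le> Y x) \<and> (\<integral>x. Y x \<partial>M) \<le> c"
  shows "integrable M (\<lambda>x. SUP q\<in>Q. X q x)" and "(\<integral>x. (SUP q\<in>Q. X q x) \<partial>M) \<le> c"
proof -
  define e where "e = from_nat_into Q"
  have e: "e i \<in> Q" "range e = Q" for i
    using Q by (auto simp: e_def from_nat_into range_from_nat_into)
  define Z where "Z n x = Max ((\<lambda>i. X (e i) x) ` {..n})" for n x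
  have Zm: "Z n \<in> borel_measurable M" for n
    unfolding Z_def using X(1) e(1) by (intro borel_measurable_Max) auto
  have Zb: "\<bar>Z n x\<bar> \<le> B" if "x \<in> space M" for n x
  proof -
    have "Z n x \<in> (\<lambda>i. X (e i) x) ` {..n}" unfolding Z_def by (rule Max_in) auto
    then show ?thesis using X(2)[OF e(1) that] by auto
  qed
  have lim: "(\<lambda>n. Z n x) \<longlonglongrightarrow> (SUP q\<in>Q. X q x)" if x: "x \<in> space M" for x
  proof -
    have bdd: "bdd_above ((\<lambda>q. X q x) ` Q)"
      using X(2)[OF _ x] by (intro bdd_aboveI2[of _ _ B]) (auto simp: abs_le_iff)
    have bddZ: "bdd_above (range (\<lambda>n. Z n x))"
      using Zb[OF x] by (intro bdd_aboveI2[of _ _ B]) (auto simp: abs_le_iff)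
    have "incseq (\<lambda>n. Z n x)"
      unfolding Z_def by (intro monoI Max_mono) auto
    with bddZ have "(\<lambda>n. Z n x) \<longlonglongrightarrow> (SUP n. Z n x)" by (rule LIMSEQ_incseq_SUP)
    moreover have "(SUP n. Z n x) = (SUP q\<in>Q. X q x)"
    proof (rule antisym)
      show "(SUP n. Z n x) \<le> (SUP q\<in>Q. X q x)"
      proof (rule cSUP_least)
        fix n
        have "Z n x \<in> (\<lambda>i. X (e i) x) ` {..n}" unfolding Z_def by (rule Max_in) auto
        then obtain i where "Z n x = X (e i) x" by blast
        then show "Z n x \<le> (SUP q\<in>Q. X q x)"
          using cSUP_upper[OF e(1) bdd] by simp
      qed simp
      show "(SUP q\<in>Q. X q x) \<le> (SUP n. Z n x)"
      proof (rule cSUP_least)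
        fix q assume "q \<in> Q"
        then obtain n where "q = e n" using e(2) by blast
        then have "X q x \<le> Z n x" unfolding Z_def by (intro Max_ge) auto
        also have "\<dots> \<le> (SUP n. Z n x)" by (rule cSUP_upper[OF _ bddZ]) simp
        finally show "X q x \<le> (SUP n. Z n x)" .
      qed (rule Q)
    qed
    ultimately show ?thesis by simp
  qed
  have m: "(\<lambda>x. SUP q\<in>Q. X q x) \<in> borel_measurable M"
    by (rule borel_measurable_LIMSEQ_real[OF lim Zm])
  show "integrable M (\<lambda>x. SUP q\<in>Q. X q x)"
    by (rule integrable_dominated_convergence[where s = Z and w = "\<lambda>_. B"])
      (use m Zm lim Zb in auto)
  have E: "(\<lambda>n. \<integral>x. Z n x \<partial>M) \<longlonglongrightarrow> (\<integral>x. (SUP q\<in>Q. X q x) \<partial>M)"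
    by (rule integral_dominated_convergence[where w = "\<lambda>_. B"]) (use m Zm lim Zb in auto)
  have "(\<integral>x. Z n x \<partial>M) \<le> c" for n
  proof -
    obtain Y where Y: "integrable M Y" "\<And>q x. q \<in> e ` {..n} \<Longrightarrow> x \<in> space M \<Longrightarrow> X q x \<le> Y x"
        "(\<integral>x. Y x \<partial>M) \<le> c"
      using finite[of "e ` {..n}"] e(1) by blast
    have "(\<integral>x. Z n x \<partial>M) \<le> (\<integral>x. Y x \<partial>M)"
    proof (rule integral_mono)
      show "integrable M (Z n)" by (rule integrable_bounded[OF Zm Zb])
      show "Z n x \<le> Y x" if "x \<in> space M" for x
        unfolding Z_def using Y(2) that by (subst Max_le_iff) auto
    qed (rule Y)
    with Y(3) show ?thesis by simp
  qed
  then show "(\<integral>x. (SUP q\<in>Q. X q x) \<partial>M) \<le> c"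
    by (intro LIMSEQ_le_const2[OF E]) auto
qed

section \<open>Brackets under a fixed demand distribution\<close>

locale inventory_demand = prob_space D for D :: "(nat \<Rightarrow> real) measure" +
  fixes h b K U :: real and L T :: nat
  assumes h: "h \<in> {0..1}" and b: "b \<in> {0..1}" and K: "K \<ge> 0" and U: "U > 0" and T: "T \<ge> 4"
    and sets_D: "sets D = sets (demand_space (T + L) U)"
begin

definition scale :: real where "scale = (real L + 1) * U + K"

text \<open>In the coordinates (\<delta>, S) all discontinuity of the reduced loss is in \<delta>;
  for fixed \<delta> it is continuous in S.\<close>

definition admissible :: "(real \<times> real) set" where
  "admissible = {(\<delta>, S). (S - \<delta>, S) \<in> sS_class h b L U}"

abbreviation rloss :: "real \<times> real \<Rightarrow> (nat \<Rightarrow> real) \<Rightarrow> real" where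
  "rloss \<theta> \<equiv> reduced_loss h b K L T (fst \<theta>) (snd \<theta>)"

lemma demand_bounds: "d \<in> space D \<Longrightarrow> i \<in> {1..T + L} \<Longrightarrow> d i \<in> {0..U}"
  using space_demand_space_bounds[of d "T + L" U i] sets_eq_imp_space_eq[OF sets_D] by simp

lemma measurable_D: "f \<in> borel_measurable (demand_space (T + L) U) \<Longrightarrow> f \<in> borel_measurable D"
  by (simp add: measurable_cong_sets[OF sets_D refl])

lemma rloss_measurable: "rloss \<theta> \<in> borel_measurable D"
  by (rule measurable_D) (rule reduced_loss_measurable)

lemma rloss_bounds: "\<theta> \<in> admissible \<Longrightarrow> d \<in> space D \<Longrightarrow> rloss \<theta> d \<in> {0..scale}"
  unfolding scale_def using h b U K T demand_bounds[of d]
  by (intro reduced_loss_bounds) (auto simp: admissible_def)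

lemma rloss_integrable: "\<theta> \<in> admissible \<Longrightarrow> integrable D (rloss \<theta>)"
  by (rule integrable_bounded[OF rloss_measurable, of _ scale]) (use rloss_bounds in fastforce)

lemma scale_pos: "0 < (real L + 1) * U" "0 < scale"
  using U K by (auto simp: scale_def intro: add_pos_nonneg)

lemma interval_count_integrable: "integrable D (\<lambda>d. interval_count T d \<delta>)"
  by (rule integrable_bounded[where B = "(real T)\<^sup>2"])
    (use interval_count_bounds[of T _ \<delta>] in \<open>auto intro!: measurable_D interval_count_measurable\<close>)

lemma mean_signed_cost_integrable:
  assumes "(\<delta>, S) \<in> admissible"
  shows "integrable D (mean_signed_cost h b L T \<delta> S)"
proof (rule integrable_bounded[where B = "(real L + 1) * U"])
  show "\<bar>mean_signed_cost h b L T \<delta> S d\<bar> \<le> (real L + 1) * U" if "d \<in> space D" for d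
    using mean_signed_cost_bounds[of S \<delta> h b L U T d] assms h b U T demand_bounds[OF that]
    by (auto simp: admissible_def abs_le_iff)
qed (rule measurable_D, rule mean_signed_cost_measurable)

text \<open>Lowering \<delta> raises s towards S and so stays in the class. This is why the least
  \<delta> of a cell serves as its reference point: it may be paired with every S of the cell. The
  largest \<delta> need not have this property and enters the brackets only through the interval
  count.\<close>

lemma admissible_antimono: "(\<delta>, S) \<in> admissible \<Longrightarrow> 0 \<le> \<delta>' \<Longrightarrow> \<delta>' \<le> \<delta> \<Longrightarrow> (\<delta>', S) \<in> admissible"
  unfolding admissible_def sS_class_def by (auto elim!: order_trans)

lemma admissible_nonneg: "(\<delta>, S) \<in> admissible \<Longrightarrow> 0 \<le> \<delta>"
  by (auto simp: admissible_def sS_class_def)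

text \<open>For a finite set the extreme parameters of each cell are attained and can serve as end
  points of the bracket. The cells depend on the set, but their number and widths are bounded
  independently of it.\<close>

lemma finite_admissible_dominated:
  assumes \<Theta>: "finite \<Theta>" "\<Theta> \<subseteq> admissible" and "N > 0"
  shows "\<exists>X. integrable (iid_sample N D) X \<and>
    (\<forall>\<theta>\<in>\<Theta>. \<forall>ds\<in>space (iid_sample N D). emp_gap D N (rloss \<theta>) ds \<le> X ds) \<and>
    (\<integral>ds. X ds \<partial>iid_sample N D) \<le> 148 * scale * sqrt (ln (real T) / real N)"
proof -
  define M where "M = (real L + 1) * U"
  have M: "0 < M" "M \<le> scale" using scale_pos K by (auto simp: M_def scale_def)
  define G where "G \<delta> = (\<integral>d. interval_count T d \<delta> \<partial>D)" for \<delta>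
  define m where "m \<delta> S = (\<integral>d. mean_signed_cost h b L T \<delta> S d \<partial>D)" for \<delta> S
  have G: "G \<delta> \<in> {0..(real T)\<^sup>2}" for \<delta>
    unfolding G_def using interval_count_bounds[of T _ \<delta>]
    by (auto intro!: integral_nonneg_AE integral_le_const interval_count_integrable)
  have m: "m \<delta> S \<in> {-M..M}" if "(\<delta>, S) \<in> admissible" for \<delta> S
  proof -
    have "mean_signed_cost h b L T \<delta> S d \<in> {-M..M}" if "d \<in> space D" for d
      using mean_signed_cost_bounds[of S \<delta> h b L U T d] \<open>(\<delta>, S) \<in> admissible\<close> h b U T demand_bounds[OF that]
      by (auto simp: admissible_def M_def)
    then show ?thesis unfolding m_def
      using mean_signed_cost_integrable[OF that] by (auto intro!: integral_le_const integral_ge_const)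
  qed
  define i where "i k \<delta> = nat \<lfloor>2 ^ k * G \<delta>\<rfloor>" for k :: nat and \<delta>
  define A where "A k n = {\<delta> \<in> fst ` \<Theta>. i k \<delta> = n}" for k n
  define lo where "lo k n = Min (A k n)" for k n
  define hi where "hi k n = Max (A k n)" for k n
  \<comment> \<open>The second cut is made separately in each cell of the first, at its reference
    \<open>lo\<close>. Adding 1 moves the normalized mean from [-1, 1] to [0, 2], so that
    \<open>nat\<close> loses nothing.\<close>
  define j where "j k n S = nat \<lfloor>2 ^ k * (m (lo k n) S / M + 1)\<rfloor>" for k n S
  define c where "c k \<theta> = (i k (fst \<theta>), j k (i k (fst \<theta>)) (snd \<theta>))" for k \<theta>
  define V where "V k p = snd ` {\<theta> \<in> \<Theta>. c k \<theta> = p}" for k p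
  define Slo where "Slo k p = Min (V k p)" for k p
  define Shi where "Shi k p = Max (V k p)" for k p
  define g where "g k p d = rloss (lo k (fst p), Slo k p) d / scale" for k p d
  \<comment> \<open>Truncation at 1 meets the range condition of the chaining and costs nothing,
    since rescaled losses differ by at most 1.\<close>
  define w where "w k p d = min 1 (interval_count T d (hi k (fst p)) - interval_count T d (lo k (fst p))
      + (mean_signed_cost h b L T (lo k (fst p)) (Shi k p) d
        - mean_signed_cost h b L T (lo k (fst p)) (Slo k p) d) / scale)" for k p d
  have finA: "finite (A k n)" and finV: "finite (V k p)" for k n p
    using \<Theta> by (auto simp: A_def V_def)
  have cell: "lo k n \<le> fst \<theta>" "fst \<theta> \<le> hi k n" "0 \<le> lo k n"
      "G (hi k n) - G (lo k n) \<le> 1 / 2 ^ k"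
      "Slo k p \<le> snd \<theta>" "snd \<theta> \<le> Shi k p"
      "(lo k n, Slo k p) \<in> admissible" "(lo k n, snd \<theta>) \<in> admissible" "(lo k n, Shi k p) \<in> admissible"
      "m (lo k n) (Shi k p) - m (lo k n) (Slo k p) \<le> M / 2 ^ k"
    if \<theta>: "\<theta> \<in> \<Theta>" and p: "p = c k \<theta>" and n: "n = fst p" for k \<theta> p n
  proof -
    have n': "n = i k (fst \<theta>)" by (simp add: n p c_def)
    have \<theta>A: "fst \<theta> \<in> A k n" using \<theta> n' by (auto simp: A_def)
    then show lo: "lo k n \<le> fst \<theta>" and "fst \<theta> \<le> hi k n"
      unfolding lo_def hi_def using finA by auto
    have loA: "lo k n \<in> A k n" and hiA: "hi k n \<in> A k n"
      unfolding lo_def hi_def using \<theta>A finA by (auto intro!: Min_in Max_in)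
    from loA obtain S where "(lo k n, S) \<in> \<Theta>" by (auto simp: A_def)
    then show lo0: "0 \<le> lo k n" using \<Theta> admissible_nonneg by blast
    \<comment> \<open>Equal floors bound the increment of the mean count across the cell. No
      continuity of \<open>G\<close> enters: a jump of more than 1 / 2^k, caused by an atom of an
      interval demand, simply separates its two sides into different cells.\<close>
    have "\<bar>2 ^ k * G (hi k n) - 2 ^ k * G (lo k n)\<bar> < 1"
      using loA hiA G by (intro abs_diff_less_of_nat_floor_eq) (auto simp: A_def i_def)
    then show "G (hi k n) - G (lo k n) \<le> 1 / 2 ^ k" by (simp add: field_simps)
    have \<theta>V: "snd \<theta> \<in> V k p" using \<theta> p by (auto simp: V_def)
    then show "Slo k p \<le> snd \<theta>" "snd \<theta> \<le> Shi k p"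
      unfolding Slo_def Shi_def using finV[of k p] by auto
    have adm: "(lo k n, S) \<in> admissible \<and> nat \<lfloor>2 ^ k * (m (lo k n) S / M + 1)\<rfloor> = snd p" if "S \<in> V k p" for S
    proof -
      from that obtain \<theta>' where \<theta>': "\<theta>' \<in> \<Theta>" "c k \<theta>' = p" "snd \<theta>' = S" by (auto simp: V_def)
      then have "i k (fst \<theta>') = n" by (simp add: n c_def flip: \<theta>'(2))
      then have "fst \<theta>' \<in> A k n" using \<theta>' by (auto simp: A_def)
      then have "lo k n \<le> fst \<theta>'" unfolding lo_def using finA by auto
      moreover have "(fst \<theta>', S) \<in> admissible" using \<theta>' \<Theta> by auto
      moreover have "snd p = j k n S"
        using \<theta>' \<open>i k (fst \<theta>') = n\<close> by (auto simp: c_def)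
      ultimately show ?thesis using admissible_antimono lo0 by (auto simp: j_def)
    qed
    have loV: "Slo k p \<in> V k p" and hiV: "Shi k p \<in> V k p"
      unfolding Slo_def Shi_def using \<theta>V finV[of k p] by (auto intro!: Min_in Max_in)
    then show a: "(lo k n, Slo k p) \<in> admissible" "(lo k n, Shi k p) \<in> admissible"
      using adm by auto
    show "(lo k n, snd \<theta>) \<in> admissible" using adm \<theta>V by auto
    have "0 \<le> m (lo k n) S / M + 1" if "(lo k n, S) \<in> admissible" for S
      using m[OF that] M by (simp add: field_simps)
    then have "\<bar>2 ^ k * (m (lo k n) (Shi k p) / M + 1) - 2 ^ k * (m (lo k n) (Slo k p) / M + 1)\<bar> < 1"
      using adm[OF loV] adm[OF hiV] a by (intro abs_diff_less_of_nat_floor_eq) auto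
    then have "2 ^ k * (m (lo k n) (Shi k p) / M + 1) - 2 ^ k * (m (lo k n) (Slo k p) / M + 1) \<le> 1"
      by linarith
    also have "2 ^ k * (m (lo k n) (Shi k p) / M + 1) - 2 ^ k * (m (lo k n) (Slo k p) / M + 1) =
        2 ^ k * (m (lo k n) (Shi k p) - m (lo k n) (Slo k p)) / M"
      by (simp add: algebra_simps diff_divide_distrib)
    finally have "2 ^ k * (m (lo k n) (Shi k p) - m (lo k n) (Slo k p)) \<le> M"
      using M by (simp add: divide_le_eq)
    then show "m (lo k n) (Shi k p) - m (lo k n) (Slo k p) \<le> M / 2 ^ k"
      by (simp add: le_divide_eq mult.commute)
  qed
  have unit: "rloss \<theta> d / scale \<in> {0..1}" if "\<theta> \<in> admissible" "d \<in> space D" for \<theta> d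
    using rloss_bounds[OF that] scale_pos by (simp add: divide_le_eq)
  have w0: "0 \<le> w k (c k \<theta>) d" if "\<theta> \<in> \<Theta>" for k \<theta> d
  proof -
    note C = cell[OF that refl refl, of k]
    have "interval_count T d (lo k (fst (c k \<theta>))) \<le> interval_count T d (hi k (fst (c k \<theta>)))"
      using C by (intro interval_count_mono) linarith
    moreover have "mean_signed_cost h b L T (lo k (fst (c k \<theta>))) (Slo k (c k \<theta>)) d
        \<le> mean_signed_cost h b L T (lo k (fst (c k \<theta>))) (Shi k (c k \<theta>)) d"
      using C h b by (intro mean_signed_cost_mono) auto
    ultimately show ?thesis using scale_pos by (simp add: w_def)
  qed
  obtain X where X: "integrable (iid_sample N D) X"
      "\<And>\<theta> ds. \<theta> \<in> \<Theta> \<Longrightarrow> ds \<in> space (iid_sample N D) \<Longrightarrow> emp_gap D N (\<lambda>d. rloss \<theta> d / scale) ds \<le> X ds"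
      "(\<integral>ds. X ds \<partial>iid_sample N D) \<le> (44 + 15 * 2) * sqrt (4 * ln (real T) / real N)"
  \<comment> \<open>The 2 for \<beta> is one unit of width for the interval count and one for the
    signed cost, whose bound \<open>M\<close> is at most \<open>scale\<close>.\<close>
  proof (rule bracketing_chaining[of N \<Theta> "4 * ln (real T)" 2 "\<lambda>\<theta> d. rloss \<theta> d / scale" g c w])
    fix \<theta> assume \<theta>: "\<theta> \<in> \<Theta>"
    then have ad: "\<theta> \<in> admissible" using \<Theta> by blast
    show "(\<lambda>d. rloss \<theta> d / scale) \<in> borel_measurable D"
      using rloss_measurable by (intro borel_measurable_divide) auto
    show "rloss \<theta> d / scale \<in> {0..1}" if "d \<in> space D" for d by (rule unit[OF ad that])
    fix k
    let ?p = "c k \<theta>" let ?n = "fst ?p"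
    note C = cell[OF \<theta> refl refl, of k]
    show "g k ?p \<in> borel_measurable D"
      unfolding g_def using rloss_measurable by (intro borel_measurable_divide) auto
    show gb: "g k ?p d \<in> {0..1}" if "d \<in> space D" for d
      unfolding g_def by (rule unit) (use C that in auto)
    have [measurable]: "(\<lambda>d. interval_count T d \<delta>) \<in> borel_measurable D"
      "mean_signed_cost h b L T \<delta> S \<in> borel_measurable D" for \<delta> S
      by (auto intro!: measurable_D interval_count_measurable mean_signed_cost_measurable)
    show wm: "w k ?p \<in> borel_measurable D"
      unfolding w_def by measurable
    show wb: "w k ?p d \<in> {0..1}" if "d \<in> space D" for d
      using w0[OF \<theta>, of k d] by (simp add: w_def)
    have "(\<integral>d. w k ?p d \<partial>D) \<le> (\<integral>d. interval_count T d (hi k ?n) - interval_count T d (lo k ?n)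
      + (mean_signed_cost h b L T (lo k ?n) (Shi k ?p) d
        - mean_signed_cost h b L T (lo k ?n) (Slo k ?p) d) / scale \<partial>D)"
    proof (rule integral_mono)
      show "integrable D (w k ?p)"
        by (rule integrable_bounded[OF wm, of 1]) (use wb in fastforce)
    qed (use C interval_count_integrable mean_signed_cost_integrable in \<open>auto simp: w_def\<close>)
    also have "\<dots> = G (hi k ?n) - G (lo k ?n) + (m (lo k ?n) (Shi k ?p) - m (lo k ?n) (Slo k ?p)) / scale"
      using C interval_count_integrable mean_signed_cost_integrable by (simp add: G_def m_def)
    also have "\<dots> \<le> 1 / 2 ^ k + 1 / 2 ^ k"
    proof (intro add_mono)
      have "(m (lo k ?n) (Shi k ?p) - m (lo k ?n) (Slo k ?p)) / scale \<le> M / 2 ^ k / scale"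
        using C scale_pos by (intro divide_right_mono) auto
      also have "\<dots> \<le> scale / 2 ^ k / scale"
        using M scale_pos by (intro divide_right_mono) auto
      finally show "(m (lo k ?n) (Shi k ?p) - m (lo k ?n) (Slo k ?p)) / scale \<le> 1 / 2 ^ k"
        using scale_pos by simp
    qed (use C in auto)
    finally show "(\<integral>d. w k ?p d \<partial>D) \<le> 2 / 2 ^ k" by simp
    show "\<bar>rloss \<theta> d / scale - g k ?p d\<bar> \<le> w k ?p d" if d: "d \<in> space D" for d
    proof -
      have le1: "\<bar>rloss \<theta> d / scale - g k ?p d\<bar> \<le> 1"
        using unit[OF ad d] gb[OF d] by auto
      define ic where "ic = interval_count T d (hi k ?n) - interval_count T d (lo k ?n)"
      define sc where "sc = (mean_signed_cost h b L T (lo k ?n) (Shi k ?p) d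
        - mean_signed_cost h b L T (lo k ?n) (Slo k ?p) d) / scale"
      have "mean_signed_cost h b L T (lo k ?n) (Slo k ?p) d
        \<le> mean_signed_cost h b L T (lo k ?n) (Shi k ?p) d"
        using C h b by (intro mean_signed_cost_mono) auto
      then have sc: "0 \<le> sc" using scale_pos by (simp add: sc_def)
      have mono: "interval_count T d (fst \<theta>) \<le> interval_count T d (hi k ?n)"
        "interval_count T d (lo k ?n) \<le> interval_count T d (fst \<theta>)"
        using C by (auto intro!: interval_count_mono)
      have "\<bar>rloss \<theta> d / scale - g k ?p d\<bar> \<le> ic + sc"
      \<comment> \<open>With an unchanged count, \<delta> may be replaced by \<open>lo\<close> at no
        cost and only S differs. With a changed count, \<open>ic\<close> alone is at least 1, which
        exceeds any difference of rescaled losses.\<close>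
      proof (cases "interval_count T d (lo k ?n) = interval_count T d (fst \<theta>)")
        case True
        have "rloss \<theta> d = rloss (lo k ?n, snd \<theta>) d"
          using reduced_loss_cong[OF C(1) True] by simp
        then have "\<bar>rloss \<theta> d - rloss (lo k ?n, Slo k ?p) d\<bar>
            \<le> mean_signed_cost h b L T (lo k ?n) (snd \<theta>) d - mean_signed_cost h b L T (lo k ?n) (Slo k ?p) d"
          using reduced_loss_diff_le[of h b "Slo k ?p" "snd \<theta>" K L T "lo k ?n" d] C h b by simp
        also have "\<dots> \<le> mean_signed_cost h b L T (lo k ?n) (Shi k ?p) d
            - mean_signed_cost h b L T (lo k ?n) (Slo k ?p) d"
          using C h b by (intro diff_right_mono mean_signed_cost_mono) auto
        finally have "\<bar>rloss \<theta> d - rloss (lo k ?n, Slo k ?p) d\<bar> / scale \<le> sc"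
          unfolding sc_def using scale_pos by (intro divide_right_mono) auto
        then have "\<bar>rloss \<theta> d / scale - g k ?p d\<bar> \<le> sc"
          using scale_pos by (simp add: g_def abs_divide flip: diff_divide_distrib)
        moreover have "0 \<le> ic" using mono by (simp add: ic_def)
        ultimately show ?thesis by simp
      next
        case False
        then have "1 \<le> ic" using interval_count_less[OF C(1) False] mono by (simp add: ic_def)
        then show ?thesis using le1 sc by simp
      qed
      then show ?thesis using le1 by (simp add: w_def ic_def sc_def)
    qed
  next
    fix k
    have "c k ` \<Theta> \<subseteq> {..2 ^ k * T\<^sup>2} \<times> {..2 * 2 ^ k}"
    proof
      fix p assume "p \<in> c k ` \<Theta>"
      then obtain \<theta> where \<theta>: "\<theta> \<in> \<Theta>" "p = c k \<theta>" by blast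
      have "2 ^ k * G (fst \<theta>) \<le> 2 ^ k * (real T)\<^sup>2" using G by (intro mult_left_mono) auto
      also have "\<dots> = real (2 ^ k * T\<^sup>2)" by simp
      finally have "\<lfloor>2 ^ k * G (fst \<theta>)\<rfloor> \<le> int (2 ^ k * T\<^sup>2)" by linarith
      then have 1: "fst p \<le> 2 ^ k * T\<^sup>2" using \<theta> by (simp add: c_def i_def nat_le_iff)
      have "(lo k (fst p), snd \<theta>) \<in> admissible" using cell(8)[OF \<theta> refl] .
      then have "m (lo k (fst p)) (snd \<theta>) / M + 1 \<le> 2" using m M by (simp add: field_simps)
      then have "2 ^ k * (m (lo k (fst p)) (snd \<theta>) / M + 1) \<le> 2 ^ k * 2" by (intro mult_left_mono) auto
      also have "\<dots> = real (2 * 2 ^ k)" by simp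
      finally have "\<lfloor>2 ^ k * (m (lo k (fst p)) (snd \<theta>) / M + 1)\<rfloor> \<le> int (2 * 2 ^ k)" by linarith
      then have 2: "snd p \<le> 2 * 2 ^ k" using \<theta> by (simp add: c_def j_def nat_le_iff)
      show "p \<in> {..2 ^ k * T\<^sup>2} \<times> {..2 * 2 ^ k}" using 1 2 by (cases p) auto
    qed
    then have "card (c k ` \<Theta>) \<le> card ({..2 ^ k * T\<^sup>2} \<times> {..(2 * 2 ^ k :: nat)})"
      by (intro card_mono) auto
    also have "\<dots> = (2 ^ k * T\<^sup>2 + 1) * (2 * 2 ^ k + 1)" by (simp add: card_cartesian_product)
    also have "\<dots> \<le> (2 * (2 ^ k * T\<^sup>2)) * (3 * 2 ^ k)"
      using T by (intro mult_mono) auto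
    also have "\<dots> = T\<^sup>2 * 6 * 4 ^ k" by (simp add: power_mult_distrib[symmetric])
    \<comment> \<open>The numerical factors are absorbed into powers of T, at k = 0 as well; T \<ge>
      4 is used here. The exponent 4 (k + 1) is the origin of 4 ln T.\<close>
    also have "\<dots> \<le> T\<^sup>2 * T\<^sup>2 * (T ^ 4) ^ k"
    proof (intro mult_mono power_mono)
      have "4 * 4 \<le> T * T" using T by (intro mult_mono) auto
      then show "6 \<le> T\<^sup>2" by (simp add: power2_eq_square)
      have "T ^ 1 \<le> T ^ 4" using T by (intro power_increasing) auto
      then show "4 \<le> T ^ 4" using T by simp
    qed auto
    also have "\<dots> = T ^ (4 * (k + 1))"
      by (simp add: power_mult [symmetric] power_add [symmetric] algebra_simps)
    finally have "real (card (c k ` \<Theta>)) \<le> real (T ^ (4 * (k + 1)))" by (rule of_nat_mono)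
    also have "\<dots> = exp (ln (real T)) ^ (4 * (k + 1))" using T by simp
    also have "\<dots> = exp (4 * ln (real T) * (real k + 1))"
      by (simp add: exp_of_nat_mult [symmetric] algebra_simps)
    finally show "real (card (c k ` \<Theta>)) \<le> exp (4 * ln (real T) * (real k + 1))" .
  qed (use \<open>N > 0\<close> \<Theta> T in auto)
  have "sqrt (4 * ln (real T) / real N) = 2 * sqrt (ln (real T) / real N)"
    using real_sqrt_mult[of 4 "ln (real T) / real N"] by simp
  with X(3) have X3: "(\<integral>ds. X ds \<partial>iid_sample N D) \<le> 148 * sqrt (ln (real T) / real N)" by simp
  have gap: "emp_gap D N (rloss \<theta>) ds = scale * emp_gap D N (\<lambda>d. rloss \<theta> d / scale) ds" for \<theta> ds
    using scale_pos by (simp add: emp_gap_def sum_divide_distrib [symmetric] field_simps)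
  show ?thesis
  proof (intro exI[of _ "\<lambda>ds. scale * X ds"] conjI ballI)
    show "integrable (iid_sample N D) (\<lambda>ds. scale * X ds)" using X(1) by simp
    show "emp_gap D N (rloss \<theta>) ds \<le> scale * X ds" if "\<theta> \<in> \<Theta>" "ds \<in> space (iid_sample N D)" for \<theta> ds
      unfolding gap using X(2)[OF that] scale_pos by (intro mult_left_mono) auto
    have "scale * (\<integral>ds. X ds \<partial>iid_sample N D) \<le> scale * (148 * sqrt (ln (real T) / real N))"
      using X3 scale_pos by (intro mult_left_mono) auto
    then show "(\<integral>ds. scale * X ds \<partial>iid_sample N D) \<le> 148 * scale * sqrt (ln (real T) / real N)"
      by (simp add: mult_ac)
  qed
qed

end

section \<open>Separability and the error bounds\<close>

context inventory_demand
begin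

definition rational_admissible :: "(real \<times> real) set" where
  "rational_admissible = admissible \<inter> (\<rat> \<times> \<rat>)"

lemma zero_admissible: "(0, 0) \<in> admissible"
proof -
  have "(real L + 1) * U * (1 - 1 / b) \<le> 0" if "b \<noteq> 0"
    using U b that by (intro mult_nonneg_nonpos) (auto simp: le_divide_eq)
  moreover have "0 \<le> (real L + 1) * U / h" using U h by simp
  ultimately show ?thesis by (auto simp: admissible_def sS_class_def H_lower_def H_upper_def)
qed

lemma H_lower_nonpos: "H_lower b L U \<le> 0"
  using zero_admissible by (simp add: admissible_def sS_class_def zero_ereal_def)

text \<open>Left continuity demands \<delta>' \<le> \<delta>, the upper limit is kept by S' \<le> S,
  and S' - \<delta>' must not fall below the lower limit. So \<delta> is lowered first, and S is
  then lowered by no more than the room this has created.\<close>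

lemma rational_approximation:
  assumes "(\<delta>, S) \<in> admissible"
  obtains \<delta>' S' where "\<And>n. (\<delta>' n, S' n) \<in> rational_admissible" "\<And>n. \<delta>' n \<le> \<delta>"
    "\<delta>' \<longlonglongrightarrow> \<delta>" "S' \<longlonglongrightarrow> S"
proof -
  have p: "H_lower b L U \<le> ereal (S - \<delta>)" "0 \<le> \<delta>" "ereal S \<le> H_upper h L U" "0 \<le> S"
    using assms by (auto simp: admissible_def sS_class_def)
  have "\<forall>n. \<exists>q. q \<in> rational_admissible \<and> \<bar>fst q - \<delta>\<bar> \<le> 1 / real (Suc n) \<and> fst q \<le> \<delta>
      \<and> \<bar>snd q - S\<bar> \<le> 1 / real (Suc n)"
  proof
    fix n
    define e where "e = 1 / real (Suc n)"
    have e: "0 < e" by (simp add: e_def)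
    have "\<exists>\<delta>'\<in>\<rat>. \<delta> - e \<le> \<delta>' \<and> 0 \<le> \<delta>' \<and> \<delta>' \<le> \<delta> \<and> (\<delta> \<noteq> 0 \<longrightarrow> \<delta>' < \<delta>)"
    proof (cases "\<delta> = 0")
      case False
      then have "max 0 (\<delta> - e) < \<delta>" using p e by simp
      from Rats_dense_in_real[OF this] obtain r where "r \<in> \<rat>" "max 0 (\<delta> - e) < r" "r < \<delta>" by blast
      then show ?thesis using False by (intro bexI[of _ r]) auto
    qed (use e in \<open>auto intro!: bexI[of _ 0]\<close>)
    then obtain \<delta>' where \<delta>': "\<delta>' \<in> \<rat>" "\<delta> - e \<le> \<delta>'" "0 \<le> \<delta>'" "\<delta>' \<le> \<delta>" "\<delta> \<noteq> 0 \<Longrightarrow> \<delta>' < \<delta>"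
      by blast
    \<comment> \<open>For \<delta> = 0 no room can be created, but then \<delta>' = 0 and the lower
      limit holds because it is nonpositive while S' is nonnegative.\<close>
    define u where "u = (if \<delta> = 0 then e else min e (\<delta> - \<delta>'))"
    have u: "0 < u" "u \<le> e" "\<delta> \<noteq> 0 \<Longrightarrow> u \<le> \<delta> - \<delta>'" using e \<delta>' by (auto simp: u_def)
    have "\<exists>S'\<in>\<rat>. S - u \<le> S' \<and> 0 \<le> S' \<and> S' \<le> S"
    proof (cases "S = 0")
      case False
      then have "max 0 (S - u) < S" using p u by simp
      from Rats_dense_in_real[OF this] obtain r where "r \<in> \<rat>" "max 0 (S - u) < r" "r < S" by blast
      then show ?thesis by (intro bexI[of _ r]) auto
    qed (use u in \<open>auto intro!: bexI[of _ 0]\<close>)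
    then obtain S' where S': "S' \<in> \<rat>" "S - u \<le> S'" "0 \<le> S'" "S' \<le> S" by blast
    have "H_lower b L U \<le> ereal (S' - \<delta>')"
    proof (cases "\<delta> = 0")
      case True
      have "H_lower b L U \<le> ereal 0" using H_lower_nonpos by (simp add: zero_ereal_def)
      also have "ereal 0 \<le> ereal (S' - \<delta>')" using \<delta>' S' True by simp
      finally show ?thesis .
    next
      case False
      note p(1)
      also have "ereal (S - \<delta>) \<le> ereal (S' - \<delta>')" using u(3)[OF False] S' by simp
      finally show ?thesis .
    qed
    moreover have "ereal S' \<le> H_upper h L U" using S' p(3) by (auto elim: order_trans[rotated])
    ultimately have "(\<delta>', S') \<in> rational_admissible"
      using \<delta>' S' by (auto simp: rational_admissible_def admissible_def sS_class_def)
    then show "\<exists>q. q \<in> rational_admissible \<and> \<bar>fst q - \<delta>\<bar> \<le> 1 / real (Suc n) \<and> fst q \<le> \<delta>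
      \<and> \<bar>snd q - S\<bar> \<le> 1 / real (Suc n)"
      using \<delta>' S' u unfolding e_def [symmetric] by (intro exI[of _ "(\<delta>', S')"]) (simp add: abs_le_iff)
  qed
  from choice[OF this] obtain q where *: "\<And>n. q n \<in> rational_admissible"
      "\<And>n. \<bar>fst (q n) - \<delta>\<bar> \<le> 1 / real (Suc n)" "\<And>n. fst (q n) \<le> \<delta>"
      "\<And>n. \<bar>snd (q n) - S\<bar> \<le> 1 / real (Suc n)"
    by blast
  have z: "(\<lambda>n. 1 / real (Suc n)) \<longlonglongrightarrow> 0" by (rule LIMSEQ_Suc[OF lim_1_over_n])
  have "(\<lambda>n. fst (q n) - \<delta>) \<longlonglongrightarrow> 0" by (rule Lim_null_comparison[OF _ z]) (use *(2) in simp)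
  then have "(\<lambda>n. fst (q n)) \<longlonglongrightarrow> \<delta>" by (rule LIM_zero_cancel)
  moreover have "(\<lambda>n. snd (q n) - S) \<longlonglongrightarrow> 0" by (rule Lim_null_comparison[OF _ z]) (use *(4) in simp)
  then have "(\<lambda>n. snd (q n)) \<longlonglongrightarrow> S" by (rule LIM_zero_cancel)
  ultimately show ?thesis using *(1,3) by (intro that[of "\<lambda>n. fst (q n)" "\<lambda>n. snd (q n)"]) auto
qed

lemma rational_admissible_countable: "countable rational_admissible"
  unfolding rational_admissible_def by (rule countable_Int2) (simp add: countable_rat)

lemma rloss_gap_measurable: "emp_gap D N (rloss \<theta>) \<in> borel_measurable (iid_sample N D)"
  using rloss_measurable by (rule emp_gap_measurable)

lemma abs_rloss_gap_le:
  assumes "\<theta> \<in> admissible" "ds \<in> space (iid_sample N D)" "N > 0"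
  shows "\<bar>emp_gap D N (rloss \<theta>) ds\<bar> \<le> scale"
  using rloss_measurable rloss_bounds[OF assms(1)] assms(2,3) by (rule abs_emp_gap_le)

lemma rloss_gap_le_SUP_rational:
  assumes \<theta>: "\<theta> \<in> admissible" and ds: "ds \<in> space (iid_sample N D)" and "N > 0"
  shows "emp_gap D N (rloss \<theta>) ds \<le> (SUP q\<in>rational_admissible. emp_gap D N (rloss q) ds)"
proof -
  obtain \<delta>' S' where q: "\<And>n. (\<delta>' n, S' n) \<in> rational_admissible"
    and lim: "\<And>n. \<delta>' n \<le> fst \<theta>" "\<delta>' \<longlonglongrightarrow> fst \<theta>" "S' \<longlonglongrightarrow> snd \<theta>"
    using rational_approximation[of "fst \<theta>" "snd \<theta>"] \<theta> by auto
  have q': "(\<delta>' n, S' n) \<in> admissible" for n using q[of n] by (simp add: rational_admissible_def)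
  have conv: "(\<lambda>n. rloss (\<delta>' n, S' n) d) \<longlonglongrightarrow> rloss \<theta> d" for d
    using reduced_loss_tendsto[OF lim] by simp
  have "(\<lambda>n. \<integral>d. rloss (\<delta>' n, S' n) d \<partial>D) \<longlonglongrightarrow> (\<integral>d. rloss \<theta> d \<partial>D)"
    using conv rloss_measurable rloss_bounds[OF q']
    by (intro integral_dominated_convergence[where w = "\<lambda>_. scale"]) auto
  then have "(\<lambda>n. emp_gap D N (rloss (\<delta>' n, S' n)) ds) \<longlonglongrightarrow> emp_gap D N (rloss \<theta>) ds"
    unfolding emp_gap_def divide_inverse by (intro tendsto_intros conv)
  then show ?thesis
  proof (rule LIMSEQ_le_const2, intro exI[of _ 0] allI impI)
    fix n
    show "emp_gap D N (rloss (\<delta>' n, S' n)) ds \<le> (SUP q\<in>rational_admissible. emp_gap D N (rloss q) ds)"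
    proof (rule cSUP_upper[OF q bdd_aboveI2])
      show "emp_gap D N (rloss \<theta>) ds \<le> scale" if "\<theta> \<in> rational_admissible" for \<theta>
        using abs_rloss_gap_le[OF _ ds \<open>N > 0\<close>, of \<theta>] that by (simp add: rational_admissible_def abs_le_iff)
    qed
  qed
qed

lemma emp_gap_sS_loss:
  assumes first: "b \<noteq> 0 \<longrightarrow> ereal x1 \<le> H_lower b L U" and p: "p \<in> sS_class h b L U" and "N > 0"
  shows "(snd p - fst p, snd p) \<in> admissible"
    and "integrable D (sS_loss h b K L T x1 p)"
    and "emp_gap D N (sS_loss h b K L T x1 p) ds = emp_gap D N (rloss (snd p - fst p, snd p)) ds"
proof -
  obtain s S where sS: "p = (s, S)" by (cases p)
  show a: "(snd p - fst p, snd p) \<in> admissible" using p by (simp add: admissible_def)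
  have "b = 0 \<or> x1 \<le> s"
  proof (cases "b = 0")
    case False
    then have "ereal x1 \<le> H_lower b L U" using first by simp
    also have "\<dots> \<le> ereal s" using p by (simp add: sS sS_class_def)
    finally show ?thesis by simp
  qed simp
  then have eq: "sS_loss h b K L T x1 p = (\<lambda>d. rloss (snd p - fst p, snd p) d + K / real T * of_bool (x1 < S))"
    using T by (intro ext) (simp add: sS sS_loss_eq)
  show "integrable D (sS_loss h b K L T x1 p)"
    unfolding eq using rloss_integrable[OF a] by simp
  have "emp_gap D N (\<lambda>_. K / real T * of_bool (x1 < S)) ds = 0"
    using \<open>N > 0\<close> by (simp add: emp_gap_def prob_space)
  then show "emp_gap D N (sS_loss h b K L T x1 p) ds = emp_gap D N (rloss (snd p - fst p, snd p)) ds"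
    unfolding eq using rloss_integrable[OF a] by (subst emp_gap_add) auto
qed

lemma sS_class_nonempty: "(0, 0) \<in> sS_class h b L U"
  using zero_admissible by (simp add: admissible_def)

context
  fixes x1 :: real and N :: nat
  assumes first: "b \<noteq> 0 \<longrightarrow> ereal x1 \<le> H_lower b L U" and N: "N > 0"
begin

lemma generalization_gap_bdd_above:
  assumes ds: "ds \<in> space (iid_sample N D)"
  shows "bdd_above ((\<lambda>p. emp_gap D N (sS_loss h b K L T x1 p) ds) ` sS_class h b L U)"
proof (rule bdd_aboveI2)
  show "emp_gap D N (sS_loss h b K L T x1 p) ds \<le> scale" if "p \<in> sS_class h b L U" for p
    using abs_rloss_gap_le[OF emp_gap_sS_loss(1)[OF first that N] ds N] emp_gap_sS_loss(3)[OF first that N]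
    by (simp add: abs_le_iff)
qed

text \<open>Replaces an uncountable supremum, whose measurability is not evident, by a countable one
  to which the bounds over finite sets extend.\<close>

lemma generalization_error_eq_SUP_rational:
  assumes ds: "ds \<in> space (iid_sample N D)"
  shows "generalization_error D N (sS_loss h b K L T x1) (sS_class h b L U) ds =
    (SUP q\<in>rational_admissible. emp_gap D N (rloss q) ds)"
  unfolding generalization_error_def risk_minus_empirical_risk
proof (rule antisym)
  show "(SUP p\<in>sS_class h b L U. emp_gap D N (sS_loss h b K L T x1 p) ds)
      \<le> (SUP q\<in>rational_admissible. emp_gap D N (rloss q) ds)"
  proof (rule cSUP_least)
    fix p assume p: "p \<in> sS_class h b L U"
    show "emp_gap D N (sS_loss h b K L T x1 p) ds \<le> (SUP q\<in>rational_admissible. emp_gap D N (rloss q) ds)"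
      unfolding emp_gap_sS_loss(3)[OF first p N]
      by (rule rloss_gap_le_SUP_rational[OF emp_gap_sS_loss(1)[OF first p N] ds N])
  qed (use sS_class_nonempty in auto)
  show "(SUP q\<in>rational_admissible. emp_gap D N (rloss q) ds)
      \<le> (SUP p\<in>sS_class h b L U. emp_gap D N (sS_loss h b K L T x1 p) ds)"
  proof (rule cSUP_least)
    show "rational_admissible \<noteq> {}" using zero_admissible by (auto simp: rational_admissible_def)
    fix q assume "q \<in> rational_admissible"
    then have p: "(snd q - fst q, snd q) \<in> sS_class h b L U"
      by (auto simp: rational_admissible_def admissible_def)
    show "emp_gap D N (rloss q) ds \<le> (SUP p\<in>sS_class h b L U. emp_gap D N (sS_loss h b K L T x1 p) ds)"
      using cSUP_upper[OF p generalization_gap_bdd_above[OF ds]] emp_gap_sS_loss(3)[OF first p N, of ds]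
      by simp
  qed
qed

lemma generalization_error_bound:
  defines "GE \<equiv> generalization_error D N (sS_loss h b K L T x1) (sS_class h b L U)"
  shows "integrable (iid_sample N D) GE"
    and "(\<integral>ds. GE ds \<partial>iid_sample N D) \<le> 148 * scale * sqrt (ln (real T) / real N)"
proof -
  interpret P: prob_space "iid_sample N D" by (rule iid_sample_prob_space)
  have sub: "rational_admissible \<subseteq> admissible" by (simp add: rational_admissible_def)
  have ne: "rational_admissible \<noteq> {}" using zero_admissible by (auto simp: rational_admissible_def)
  have eq: "GE ds = (SUP q\<in>rational_admissible. emp_gap D N (rloss q) ds)" if "ds \<in> space (iid_sample N D)" for ds
    unfolding GE_def by (rule generalization_error_eq_SUP_rational[OF that])
  have fin: "\<exists>Y. integrable (iid_sample N D) Y \<and>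
      (\<forall>q\<in>F. \<forall>ds\<in>space (iid_sample N D). emp_gap D N (rloss q) ds \<le> Y ds) \<and>
      (\<integral>ds. Y ds \<partial>iid_sample N D) \<le> 148 * scale * sqrt (ln (real T) / real N)"
    if "finite F" "F \<subseteq> rational_admissible" for F
    by (rule finite_admissible_dominated[OF that(1) order_trans[OF that(2) sub] N])
  have bnd: "\<bar>emp_gap D N (rloss q) ds\<bar> \<le> scale"
    if "q \<in> rational_admissible" "ds \<in> space (iid_sample N D)" for q ds
    by (rule abs_rloss_gap_le[OF subsetD[OF sub that(1)] that(2) N])
  note * = P.countable_SUP_integral_le[where X = "\<lambda>q. emp_gap D N (rloss q)",
      OF rational_admissible_countable ne rloss_gap_measurable bnd fin]
  show "integrable (iid_sample N D) GE"
    using *(1) by (subst Bochner_Integration.integrable_cong[OF refl eq])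
  show "(\<integral>ds. GE ds \<partial>iid_sample N D) \<le> 148 * scale * sqrt (ln (real T) / real N)"
    using *(2) by (subst Bochner_Integration.integral_cong[OF refl eq])
qed

text \<open>The excess risk is the gap of the empirical minimizer, plus a nonpositive difference of
  empirical risks, minus the gap of the true minimizer. The first is at most the supremum, and the
  last has mean zero since its policy is fixed before sampling. Optimality of \<open>p_star\<close>
  gives EE \<ge> 0, so the same upper bound yields integrability; measurability is assumed because
  \<open>p_hat\<close> is an arbitrary selection.\<close>

lemma estimation_error_le_generalization_error:
  assumes hat: "AE ds in iid_sample N D. is_arg_min (empirical_risk N ds (sS_loss h b K L T x1))
      (\<lambda>\<pi>. \<pi> \<in> sS_class h b L U) (p_hat ds)"
    and star: "is_arg_min (risk D (sS_loss h b K L T x1)) (\<lambda>\<pi>. \<pi> \<in> sS_class h b L U) p_star"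
    and meas: "(\<lambda>ds. estimation_error D (sS_loss h b K L T x1) (p_hat ds) p_star)
      \<in> borel_measurable (iid_sample N D)"
  defines "EE \<equiv> \<lambda>ds. estimation_error D (sS_loss h b K L T x1) (p_hat ds) p_star"
    and "GE \<equiv> generalization_error D N (sS_loss h b K L T x1) (sS_class h b L U)"
  shows "integrable (iid_sample N D) EE"
    and "(\<integral>ds. EE ds \<partial>iid_sample N D) \<le> (\<integral>ds. GE ds \<partial>iid_sample N D)"
proof -
  let ?loss = "sS_loss h b K L T x1"
  let ?P = "iid_sample N D"
  interpret P: prob_space ?P by (rule iid_sample_prob_space)
  have iG: "integrable ?P GE" unfolding GE_def by (rule generalization_error_bound)
  have p: "p_star \<in> sS_class h b L U" using star by (simp add: is_arg_min_def)
  have il: "integrable D (?loss p_star)" by (rule emp_gap_sS_loss(2)[OF first p N])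
  have gap_eq: "emp_gap D N (?loss p_star) ds = emp_gap D N (rloss (snd p_star - fst p_star, snd p_star)) ds" for ds
    by (rule emp_gap_sS_loss(3)[OF first p N])
  have igap: "integrable ?P (emp_gap D N (?loss p_star))"
    unfolding gap_eq
    by (rule P.integrable_bounded[OF rloss_gap_measurable abs_rloss_gap_le[OF emp_gap_sS_loss(1)[OF first p N] _ N]])
  have gap0: "(\<integral>ds. emp_gap D N (?loss p_star) ds \<partial>?P) = 0"
  proof -
    have ic: "integrable ?P (\<lambda>ds. ?loss p_star (ds i))" if "i \<in> {1..N}" for i
      by (rule integrable_iid_sample_component[OF il that])
    then have isum: "integrable ?P (\<lambda>ds. \<Sum>i = 1..N. ?loss p_star (ds i))"
      by (rule Bochner_Integration.integrable_sum)
    have esum: "(\<integral>ds. (\<Sum>i = 1..N. ?loss p_star (ds i)) \<partial>?P) = (\<Sum>i = 1..N. \<integral>ds. ?loss p_star (ds i) \<partial>?P)"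
      by (rule Bochner_Integration.integral_sum) (rule ic)
    have "(\<integral>ds. emp_gap D N (?loss p_star) ds \<partial>?P) =
        (\<integral>d. ?loss p_star d \<partial>D) - (\<Sum>i = 1..N. \<integral>ds. ?loss p_star (ds i) \<partial>?P) / real N"
      unfolding emp_gap_def using isum esum by (simp add: P.prob_space)
    also have "(\<Sum>i = 1..N. \<integral>ds. ?loss p_star (ds i) \<partial>?P) = (\<Sum>i = 1..N. \<integral>d. ?loss p_star d \<partial>D)"
      using il by (intro sum.cong integral_iid_sample_component) auto
    finally show ?thesis using N by simp
  qed
  have bound: "AE ds in ?P. 0 \<le> EE ds \<and> EE ds \<le> GE ds - emp_gap D N (?loss p_star) ds"
    using hat AE_space
  proof eventually_elim
    fix ds
    assume m: "is_arg_min (empirical_risk N ds ?loss) (\<lambda>\<pi>. \<pi> \<in> sS_class h b L U) (p_hat ds)"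
      and ds: "ds \<in> space ?P"
    then have ph: "p_hat ds \<in> sS_class h b L U" and "empirical_risk N ds ?loss (p_hat ds) \<le> empirical_risk N ds ?loss p_star"
      using p unfolding is_arg_min_def by (blast intro: leI)+
    moreover have "risk D ?loss p_star \<le> risk D ?loss (p_hat ds)"
      using star ph unfolding is_arg_min_def by (blast intro: leI)
    moreover have "emp_gap D N (?loss (p_hat ds)) ds \<le> GE ds"
      unfolding GE_def generalization_error_def risk_minus_empirical_risk
      by (rule cSUP_upper[OF ph generalization_gap_bdd_above[OF ds]])
    ultimately show "0 \<le> EE ds \<and> EE ds \<le> GE ds - emp_gap D N (?loss p_star) ds"
      by (simp add: EE_def estimation_error_def risk_minus_empirical_risk [symmetric])
  qed
  show iE: "integrable ?P EE"
  proof (rule Bochner_Integration.integrable_bound)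
    show "integrable ?P (\<lambda>ds. GE ds - emp_gap D N (?loss p_star) ds)" using iG igap by simp
    show "EE \<in> borel_measurable ?P" unfolding EE_def by (rule meas)
    show "AE ds in ?P. norm (EE ds) \<le> norm (GE ds - emp_gap D N (?loss p_star) ds)"
      using bound by eventually_elim auto
  qed
  have "(\<integral>ds. EE ds \<partial>?P) \<le> (\<integral>ds. GE ds - emp_gap D N (?loss p_star) ds \<partial>?P)"
    using bound iE iG igap by (intro integral_mono_AE) auto
  also have "\<dots> = (\<integral>ds. GE ds \<partial>?P)" using iG igap gap0 by simp
  finally show "(\<integral>ds. EE ds \<partial>?P) \<le> (\<integral>ds. GE ds \<partial>?P)" .
qed

end

end

theorem corollary2:
  "\<exists>(C::real) (T0::nat). C > 0 \<and> T0 > 0 \<and>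
    (\<forall>(b::real) (h::real) (K::real) (L::nat) (U::real) (T::nat) (x1::real)
        (D::(nat \<Rightarrow> real) measure) (N::nat).
      b \<in> {0..1} \<longrightarrow> h \<in> {0..1} \<longrightarrow> K \<ge> 0 \<longrightarrow> U > 0 \<longrightarrow> T \<ge> T0 \<longrightarrow> N > 0 \<longrightarrow>
      x1 \<le> 0 \<longrightarrow> (b \<noteq> 0 \<longrightarrow> ereal x1 \<le> H_lower b L U) \<longrightarrow>
      prob_space D \<longrightarrow> sets D = sets (demand_space (T + L) U) \<longrightarrow>
      (let policies = sS_class h b L U;
           loss = sS_loss h b K L T x1;
           P = iid_sample N D;
           GE = generalization_error D N loss policies
       in
         (\<forall>(\<pi>_hat :: (nat \<Rightarrow> nat \<Rightarrow> real) \<Rightarrow> real \<times> real) (\<pi>_star :: real \<times> real).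
            (AE ds in P. is_arg_min (empirical_risk N ds loss) (\<lambda>\<pi>. \<pi> \<in> policies) (\<pi>_hat ds)) \<longrightarrow>
            is_arg_min (risk D loss) (\<lambda>\<pi>. \<pi> \<in> policies) \<pi>_star \<longrightarrow>
            (\<lambda>ds. estimation_error D loss (\<pi>_hat ds) \<pi>_star) \<in> borel_measurable P \<longrightarrow>
            integrable P (\<lambda>ds. estimation_error D loss (\<pi>_hat ds) \<pi>_star) \<and>
            (\<integral>ds. estimation_error D loss (\<pi>_hat ds) \<pi>_star \<partial>P) \<le> (\<integral>ds. GE ds \<partial>P)) \<and>
         integrable P GE \<and>
         (\<integral>ds. GE ds \<partial>P) \<le> C * ((real L + 1) * U + K) * sqrt (ln (real T) / real N)))"
proof (intro exI[of _ "148::real"] exI[of _ "4::nat"] conjI allI impI, goal_cases)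
  case (3 b h K L U T x1 D N)
  interpret prob_space D by (rule 3)
  interpret inventory_demand D h b K U L T using 3 by unfold_locales auto
  show ?case
    unfolding Let_def scale_def [symmetric]
    by (intro conjI allI impI estimation_error_le_generalization_error[OF 3(8,6)]
        generalization_error_bound[OF 3(8,6)])
qed simp_all

end
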